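(* Assume: (A1) the solution set $S_1$ of the variational inequality is nonempty; (A3) $F$ has a stochastic oracle $F_\xi$ that is variable $\bar L$-Lipschitz in mean; (A4) $\|F(x)-F(y)\|_*\le L\|x-y\|$ for all $x,y\in K$; (A5) there exist $x^*\in K$ and $\rho>0$ such that $-\rho\|w\|_*^2\le\langle w,x-x^*\rangle$ for all $x\in K$ and all $w\in F(x)+\partial(g+\mathrm I_K)(x)$; (A6) for some $L_f>0$, $\|\nabla f(x)-\nabla f(y)\|_*\le L_f\|x-y\|$ for all $x,y\in K$. Let $\{x_s\}$ be generated by the algorithm with $p=1$. Set $$\sigma_1'=\left(\gamma-\frac12\right)-\left(4\alpha^2L^2+16\alpha\rho L^2+\frac{8\alpha\rho\bar L^2}{b}+\frac{5\alpha^2\bar L^2}{b}+\frac{8\gamma\rho L_f^2}{\alpha}\right),\qquad \sigma_2'=16L^2+\frac{8\gamma L_f^2}{\alpha^2}+\frac{8\bar L^2}{b}.$$ If $\sigma_1'>0$ and $$(1-\gamma)\left(\frac{\sigma_1'}{\sigma_2'}\left(\frac{8\rho L_f^2}{\alpha}-1\right)+\frac{8L_f^2}{\alpha^2}\right)\le0,$$ then $$\mathbb E\left[\sum_{s=0}^{S-1}\|u_s\|_*^2\right]\le\frac{(3-\gamma)\sigma_2'}{\sigma_1'}D(x^*,x_0),$$ where $u_s=F(x_{s+1})-\Delta^s-\frac1\alpha\Big(\nabla f(x_{s+1})-\big(\gamma\nabla f(x_s)+(1-\gamma)\nabla f(x_{s-1})\big)\Big)$.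
   Context: Setting. $\mathcal X$ is a finite-dimensional space with inner product $\langle\cdot,\cdot\rangle$ and a norm $\|\cdot\|$ with dual norm $\|\cdot\|_*$. $K\subset\mathcal X$ is nonempty, closed and convex, with indicator function $\mathrm I_K$ ($0$ on $K$, $+\infty$ elsewhere); $g:K\to(-\infty,+\infty]$ is proper, convex, lower semicontinuous; $F:\mathrm{dom}\,g\to\mathcal X$ is an operator of the form $F=\frac1M\sum_{i=1}^M F_i$. The variational inequality is: find $x^*\in K$ with $\langle F(x^* ),y-x^*\rangle+g(y)-g(x^* )\ge 0$ for all $y\in K$; $S_1$ is its solution set. $\partial$ denotes the convex subdifferential. Bregman distance. $f:K\to(-\infty,+\infty]$ is proper, convex, lower semicontinuous, $\mathrm{dom}\,g\subset\mathrm{dom}\,f$, $f$ is differentiable on $\mathrm{dom}(\partial f)=\{x\in\mathrm{dom} f:\partial f(x)\ne\emptyset\}$ and 1-strongly convex: $f(x)\ge f(y)+\langle\nabla f(y),x-y\rangle+\frac12\|x-y\|^2$ for $x\in\mathrm{dom} f$, $y\in\mathrm{dom}(\partial f)$. $D(x,y)=f(x)-f(y)-\langle\nabla f(y),x-y\rangle$ for $x\in\mathrm{dom}\,g$, $y\in\mathrm{dom}(\partial f)$. Stochastic oracle. $F$ has a stochastic oracle $F_\xi$ that is variable $\bar L$-Lipschitz in mean if for any $x,y\in\mathrm{dom}\,g$ there is a distribution $Q_{x,y}$ of $\xi$ such that (i) $F(z)=\mathbb E_{\xi\sim Q_{x,y}}[F_\xi(z)]$ for all $z\in\mathrm{dom}\,g$;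 (ii) $\mathbb E_{\xi\sim Q_{x,y}}[\|F_\xi(x)-F_\xi(y)\|_*^2]\le\bar L^2\|x-y\|^2$. Algorithm. Parameters: $0<\gamma\le1$, $0<p\le1$, stepsize $\alpha>0$, batch size $b\in\{1,\dots,M\}$. Start with $x_0=x_{-1}=w_0=w_{-1}\in K$. For $s=0,1,\dots,S-1$: draw $\xi^s_1,\dots,\xi^s_b\in\{1,\dots,M\}$ independently from $Q_{x_s,w_{s-1}}$ and set $B^s=\{\xi_1^s,\dots,\xi_b^s\}$ (with multiplicity); set $\bar x_s=(\nabla f)^{-1}\big(\gamma\nabla f(x_s)+(1-\gamma)\nabla f(x_{s-1})\big)$; $\Delta^s=\frac1b\sum_{\xi\in B^s}\big(F(w_s)+F_\xi(x_s)-F_\xi(w_{s-1})\big)$; $x_{s+1}=\arg\min_{x\in K}\{\alpha g(x)+\langle\alpha\Delta^s,x\rangle+D(x,\bar x_s)\}$; and let $w_{s+1}=x_{s+1}$ with probability $p$ and $w_{s+1}=x_s$ with probability $1-p$ (fresh independent coin). Thus for $p=1$ one has $w_s=x_s$. All iterates are assumed well defined, i.e. the points used as second arguments of $D$ lie in $\mathrm{dom}(\partial f)$. *)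

theory Defs
  imports "HOL-Probability.Probability"
begin

text \<open>The Euclidean space \<open>'a\<close> supplies the space and its inner product. The norm
  used in the estimates is a separate function \<open>N\<close>; it need not be induced by the inner product.\<close>

definition is_norm :: "('a::real_vector \<Rightarrow> real) \<Rightarrow> bool" where
  "is_norm N \<longleftrightarrow>
     (\<forall>x. 0 \<le> N x) \<and> (\<forall>x. N x = 0 \<longleftrightarrow> x = 0) \<and>
     (\<forall>c x. N (c *\<^sub>R x) = \<bar>c\<bar> * N x) \<and>
     (\<forall>x y. N (x + y) \<le> N x + N y)"

definition dual_norm :: "('a::euclidean_space \<Rightarrow> real) \<Rightarrow> 'a \<Rightarrow> real" where
  "dual_norm N w = Sup {w \<bullet> x |x. N x \<le> 1}"

text \<open>A function \<open>K \<rightarrow> (-\<infinity>, +\<infinity>]\<close> is represented by its usual extension to the whole space,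
  with value \<open>\<infinity>\<close> outside \<open>K\<close>. As \<open>K\<close> is closed and convex, convexity and lower semicontinuity
  on \<open>K\<close> and of the extension are the same.\<close>

definition edom :: "('a \<Rightarrow> ereal) \<Rightarrow> 'a set" where
  "edom h = {x. h x < \<infinity>}"

definition convex_indicator :: "'a set \<Rightarrow> 'a \<Rightarrow> ereal" where
  "convex_indicator K x = (if x \<in> K then 0 else \<infinity>)"

definition proper_fun :: "('a \<Rightarrow> ereal) \<Rightarrow> bool" where
  "proper_fun h \<longleftrightarrow> (\<forall>x. h x \<noteq> -\<infinity>) \<and> edom h \<noteq> {}"

definition convex_fun :: "('a::real_vector \<Rightarrow> ereal) \<Rightarrow> bool" where
  "convex_fun h \<longleftrightarrow>
     (\<forall>x y t. 0 < t \<and> t < 1 \<longrightarrow>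
        h ((1 - t) *\<^sub>R x + t *\<^sub>R y) \<le> ereal (1 - t) * h x + ereal t * h y)"

definition lsc_fun :: "('a::topological_space \<Rightarrow> ereal) \<Rightarrow> bool" where
  "lsc_fun h \<longleftrightarrow> (\<forall>x. h x \<le> Liminf (at x) h)"

definition pcl_on :: "'a::euclidean_space set \<Rightarrow> ('a \<Rightarrow> ereal) \<Rightarrow> bool" where
  "pcl_on K h \<longleftrightarrow> (\<forall>x. x \<notin> K \<longrightarrow> h x = \<infinity>) \<and> proper_fun h \<and> convex_fun h \<and> lsc_fun h"

definition subdifferential :: "('a::euclidean_space \<Rightarrow> ereal) \<Rightarrow> 'a \<Rightarrow> 'a set" where
  "subdifferential h x = {v. \<bar>h x\<bar> \<noteq> \<infinity> \<and> (\<forall>y. h x + ereal (v \<bullet> (y - x)) \<le> h y)}"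

definition dom_subdiff :: "('a::euclidean_space \<Rightarrow> ereal) \<Rightarrow> 'a set" where
  "dom_subdiff h = {x \<in> edom h. subdifferential h x \<noteq> {}}"

text \<open>Differentiability is relative to the effective domain, so that boundary points of the
  domain are allowed; the gradient is required to be unique, so that \<open>\<nabla>h(x)\<close> is meaningful. At an
  interior point of the domain uniqueness is automatic and this is Frechet differentiability.
  \<open>real_of_ereal\<close> is harmless since only values on the effective domain enter.\<close>

definition has_grad :: "('a::euclidean_space \<Rightarrow> ereal) \<Rightarrow> 'a \<Rightarrow> 'a \<Rightarrow> bool" where
  "has_grad h x v \<longleftrightarrow>
     ((\<lambda>z. real_of_ereal (h z)) has_derivative (\<lambda>d. v \<bullet> d)) (at x within edom h)"

definition grad_differentiable :: "('a::euclidean_space \<Rightarrow> ereal) \<Rightarrow> 'a \<Rightarrow> bool" where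
  "grad_differentiable h x \<longleftrightarrow> (\<exists>!v. has_grad h x v)"

definition grad :: "('a::euclidean_space \<Rightarrow> ereal) \<Rightarrow> 'a \<Rightarrow> 'a" where
  "grad h x = (THE v. has_grad h x v)"

definition bregman :: "('a::euclidean_space \<Rightarrow> ereal) \<Rightarrow> 'a \<Rightarrow> 'a \<Rightarrow> ereal" where
  "bregman f x y = f x - f y - ereal (grad f y \<bullet> (x - y))"

definition bregman_generator ::
  "('a::euclidean_space \<Rightarrow> real) \<Rightarrow> 'a set \<Rightarrow> ('a \<Rightarrow> ereal) \<Rightarrow> ('a \<Rightarrow> ereal) \<Rightarrow> bool" where
  "bregman_generator N K g f \<longleftrightarrow>
     pcl_on K f \<and> edom g \<subseteq> edom f \<and>
     (\<forall>x \<in> dom_subdiff f. grad_differentiable f x) \<and>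
     (\<forall>x \<in> edom f. \<forall>y \<in> dom_subdiff f.
        f y + ereal (grad f y \<bullet> (x - y)) + ereal (1/2 * (N (x - y))\<^sup>2) \<le> f x)"

text \<open>The operator \<open>F\<close> has domain \<open>edom g\<close>, so a solution must lie there.\<close>

definition vi_solutions ::
  "'a::euclidean_space set \<Rightarrow> ('a \<Rightarrow> ereal) \<Rightarrow> ('a \<Rightarrow> 'a) \<Rightarrow> 'a set" where
  "vi_solutions K g F =
     {x \<in> K \<inter> edom g. \<forall>y \<in> K. 0 \<le> ereal (F x \<bullet> (y - x)) + g y - g x}"

definition variable_lipschitz_oracle ::
  "('a::euclidean_space \<Rightarrow> real) \<Rightarrow> ('a \<Rightarrow> ereal) \<Rightarrow> ('a \<Rightarrow> 'a) \<Rightarrow> nat \<Rightarrow>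
   (nat \<Rightarrow> 'a \<Rightarrow> 'a) \<Rightarrow> ('a \<Rightarrow> 'a \<Rightarrow> nat pmf) \<Rightarrow> real \<Rightarrow> bool" where
  "variable_lipschitz_oracle N g F M F\<xi> Q Lbar \<longleftrightarrow>
     (\<forall>x \<in> edom g. \<forall>y \<in> edom g.
        set_pmf (Q x y) \<subseteq> {1..M} \<and>
        (\<forall>z \<in> edom g. F z = measure_pmf.expectation (Q x y) (\<lambda>\<xi>. F\<xi> \<xi> z)) \<and>
        measure_pmf.expectation (Q x y) (\<lambda>\<xi>. (dual_norm N (F\<xi> \<xi> x - F\<xi> \<xi> y))\<^sup>2)
          \<le> Lbar\<^sup>2 * (N (x - y))\<^sup>2)"

text \<open>A trajectory records \<open>x\<^sub>s\<close>, \<open>w\<^sub>s\<close> and \<open>\<Delta>\<^sup>s\<close>; the integer index accommodates \<open>s = -1\<close>.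
  Entries not yet computed are dummies.\<close>

datatype 'a trajectory = Trajectory (iter: "int \<Rightarrow> 'a") (wpt: "int \<Rightarrow> 'a") (dlt: "int \<Rightarrow> 'a")

definition mirror_avg ::
  "('a::euclidean_space \<Rightarrow> ereal) \<Rightarrow> real \<Rightarrow> 'a trajectory \<Rightarrow> int \<Rightarrow> 'a" where
  "mirror_avg f \<gamma> h s = \<gamma> *\<^sub>R grad f (iter h s) + (1 - \<gamma>) *\<^sub>R grad f (iter h (s - 1))"

definition mirror_pt ::
  "('a::euclidean_space \<Rightarrow> ereal) \<Rightarrow> real \<Rightarrow> 'a trajectory \<Rightarrow> int \<Rightarrow> 'a" where
  "mirror_pt f \<gamma> h s = the_inv_into (dom_subdiff f) (grad f) (mirror_avg f \<gamma> h s)"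

definition prox_objective ::
  "('a::euclidean_space \<Rightarrow> ereal) \<Rightarrow> ('a \<Rightarrow> ereal) \<Rightarrow> real \<Rightarrow> 'a \<Rightarrow> 'a \<Rightarrow> 'a \<Rightarrow> ereal" where
  "prox_objective f g \<alpha> \<Delta> y x = ereal \<alpha> * g x + ereal ((\<alpha> *\<^sub>R \<Delta>) \<bullet> x) + bregman f x y"

definition batch_estimate ::
  "('a::euclidean_space \<Rightarrow> 'a) \<Rightarrow> (nat \<Rightarrow> 'a \<Rightarrow> 'a) \<Rightarrow> nat \<Rightarrow> 'a trajectory \<Rightarrow> int \<Rightarrow> nat list \<Rightarrow> 'a"
  where
  "batch_estimate F F\<xi> b h s B =
     (1 / real b) *\<^sub>R
       (\<Sum>\<xi>\<leftarrow>B. F (wpt h s) + F\<xi> \<xi> (iter h s) - F\<xi> \<xi> (wpt h (s - 1)))"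

definition algorithm_step ::
  "'a::euclidean_space set \<Rightarrow> ('a \<Rightarrow> ereal) \<Rightarrow> ('a \<Rightarrow> ereal) \<Rightarrow> ('a \<Rightarrow> 'a) \<Rightarrow>
   (nat \<Rightarrow> 'a \<Rightarrow> 'a) \<Rightarrow> ('a \<Rightarrow> 'a \<Rightarrow> nat pmf) \<Rightarrow> real \<Rightarrow> real \<Rightarrow> real \<Rightarrow> nat \<Rightarrow>
   int \<Rightarrow> 'a trajectory \<Rightarrow> 'a trajectory pmf" where
  "algorithm_step K f g F F\<xi> Q \<gamma> p \<alpha> b s h =
     do {
       B \<leftarrow> replicate_pmf b (Q (iter h s) (wpt h (s - 1)));
       let \<Delta> = batch_estimate F F\<xi> b h s B;
       let x' = arg_min_on (prox_objective f g \<alpha> \<Delta> (mirror_pt f \<gamma> h s)) K;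
       c \<leftarrow> bernoulli_pmf p;
       return_pmf
         (Trajectory
            ((iter h)(s + 1 := x'))
            ((wpt h)(s + 1 := (if c then x' else iter h s)))
            ((dlt h)(s := \<Delta>)))
     }"

primrec algorithm_run ::
  "'a::euclidean_space set \<Rightarrow> ('a \<Rightarrow> ereal) \<Rightarrow> ('a \<Rightarrow> ereal) \<Rightarrow> ('a \<Rightarrow> 'a) \<Rightarrow>
   (nat \<Rightarrow> 'a \<Rightarrow> 'a) \<Rightarrow> ('a \<Rightarrow> 'a \<Rightarrow> nat pmf) \<Rightarrow> real \<Rightarrow> real \<Rightarrow> real \<Rightarrow> nat \<Rightarrow>
   'a \<Rightarrow> nat \<Rightarrow> 'a trajectory pmf" where
  "algorithm_run K f g F F\<xi> Q \<gamma> p \<alpha> b x0 0 =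
     return_pmf (Trajectory (\<lambda>_. x0) (\<lambda>_. x0) (\<lambda>_. 0))"
| "algorithm_run K f g F F\<xi> Q \<gamma> p \<alpha> b x0 (Suc s) =
     bind_pmf (algorithm_run K f g F F\<xi> Q \<gamma> p \<alpha> b x0 s)
       (algorithm_step K f g F F\<xi> Q \<gamma> p \<alpha> b (int s))"

text \<open>The first \<open>S\<close> steps are well defined: \<open>F\<close> can be evaluated at the starting point, and along
  every trajectory of positive probability the gradients at the iterates, the mirror points and
  the minimisers exist.\<close>

definition iterates_well_defined ::
  "'a::euclidean_space set \<Rightarrow> ('a \<Rightarrow> ereal) \<Rightarrow> ('a \<Rightarrow> ereal) \<Rightarrow> real \<Rightarrow> real \<Rightarrow>
   'a \<Rightarrow> nat \<Rightarrow> 'a trajectory pmf \<Rightarrow> bool" where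
  "iterates_well_defined K f g \<gamma> \<alpha> x0 S R \<longleftrightarrow>
     x0 \<in> edom g \<and>
     (\<forall>h \<in> set_pmf R.
        (\<forall>s \<in> {0..int S}. iter h s \<in> dom_subdiff f) \<and>
        (\<forall>s \<in> {0..<int S}.
           mirror_avg f \<gamma> h s \<in> grad f ` dom_subdiff f \<and>
           (\<exists>z. is_arg_min (prox_objective f g \<alpha> (dlt h s) (mirror_pt f \<gamma> h s)) (\<lambda>x. x \<in> K) z)))"

definition residual ::
  "('a::euclidean_space \<Rightarrow> ereal) \<Rightarrow> ('a \<Rightarrow> 'a) \<Rightarrow> real \<Rightarrow> real \<Rightarrow> 'a trajectory \<Rightarrow> int \<Rightarrow> 'a" where
  "residual f F \<gamma> \<alpha> h s =
     F (iter h (s + 1)) - dlt h s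
       - (1 / \<alpha>) *\<^sub>R (grad f (iter h (s + 1)) - mirror_avg f \<gamma> h s)"

end

theory Submission
  imports Defs
begin

text \<open>The bound comes from a Lyapunov function. For consecutive iterates \<open>x\<close>, \<open>x'\<close> let the energy be
  \<open>D(xstar, x) + (1 - \<gamma>) D(xstar, x')\<close>, minus \<open>\<alpha>\<close> times the inner product of \<open>F x - F x'\<close> with
  \<open>x - xstar\<close>, plus \<open>\<beta>\<close> times the squared displacement. The proximal step is an explicit equation
  once the residual \<open>u\<close> is seen to be the sum of \<open>F\<close> and a subgradient of \<open>g\<close> at the new iterate, so the
  three-point identity for Bregman distances expresses the new energy through the old one. The
  weak Minty inequality costs \<open>\<alpha> * \<rho>\<close> times the squared residual; the operator differences telescope;
  the Bregman distances of the new iterate to the two previous ones are gained. The residual is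
  itself a sum of operator differences, gradient differences and sampling noise, hence is bounded by the
  displacements and the noise. The hypothesis \<open>\<sigma>1 > 0\<close> ensures that the gain pays for all of
  this and leaves \<open>\<sigma>1 / \<sigma>2\<close> times the squared residual to spare. So the energy plus \<open>\<sigma>1 / \<sigma>2\<close> times
  the accumulated squared residuals decreases in expectation; it starts at \<open>(2 - \<gamma>) D(xstar, x0)\<close>, and
  the energy is nonnegative.\<close>

text \<open>The delicate point is the sampling noise. In a Hilbert norm averaging \<open>b\<close> independent samples
  divides the variance by \<open>b\<close>; for a general norm it does not. What rescues the factor \<open>1/b\<close> is the
  kernel \<open>f\<close>: as \<open>f\<close> is strongly convex, its Fenchel conjugate is smooth with respect to
  the dual norm, and for the Bregman distance of the conjugate variances of independent centred
  sums do add up (\<open>expectation_smooth_batch_mean\<close>). The descent inequality uses this distance directly, through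
  the Fenchel--Young inequality. Where the dual norm of the noise itself is required, in the bound on
  the residual, Lipschitz continuity of \<open>grad f\<close> bounds the dual norm by the same distance up to the
  factor \<open>Lf\<^sup>2\<close>, at least for small vectors at an interior point of the domain, and homogeneity
  does the rest (\<open>dual_norm_batch_mean_second_moment\<close>). The resulting loss is absorbed by the
  summand \<open>8 * \<gamma> * Lf\<^sup>2 / \<alpha>\<^sup>2\<close> of \<open>\<sigma>2\<close>.\<close>

section \<open>Norms on a Euclidean space and their duals\<close>

locale finite_dim_norm =
  fixes N :: "'a::euclidean_space \<Rightarrow> real"
  assumes norm: "is_norm N"
begin

lemma N_nonneg [simp]: "0 \<le> N x"
  using norm by (simp add: is_norm_def)

lemma N_eq_0_iff [simp]: "N x = 0 \<longleftrightarrow> x = 0"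
  using norm by (simp add: is_norm_def)

lemma N_zero [simp]: "N 0 = 0"
  by (rule N_eq_0_iff[THEN iffD2, OF refl])

lemma N_scaleR: "N (c *\<^sub>R x) = \<bar>c\<bar> * N x"
  using norm by (simp add: is_norm_def)

lemma N_triangle: "N (x + y) \<le> N x + N y"
  using norm by (simp add: is_norm_def)

lemma N_minus [simp]: "N (- x) = N x"
  using N_scaleR[of "-1" x] by simp

lemma N_minus_commute: "N (x - y) = N (y - x)"
  using N_minus[of "x - y"] by simp

lemma N_sum: "N (\<Sum>i\<in>A. h i) \<le> (\<Sum>i\<in>A. N (h i))"
proof (induction A rule: infinite_finite_induct)
  case (insert i A)
  then show ?case using N_triangle[of "h i" "\<Sum>i\<in>A. h i"] by simp
qed auto

text \<open>Equivalence of \<open>N\<close> with the Euclidean norm, in both directions. It makes the supremum in the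
  dual norm finite, and it lets compactness and openness, which refer to the Euclidean norm, be used
  for quantities controlled by \<open>N\<close>.\<close>
lemma N_le_norm:
  obtains C where "C > 0" "\<And>x. N x \<le> C * norm x"
proof
  show "1 + (\<Sum>b\<in>Basis. N b) > 0"
    by (intro add_pos_nonneg sum_nonneg) auto
  fix x :: 'a
  have "N x = N (\<Sum>b\<in>Basis. (x \<bullet> b) *\<^sub>R b)"
    by (simp add: euclidean_representation)
  also have "\<dots> \<le> (\<Sum>b\<in>Basis. \<bar>x \<bullet> b\<bar> * N b)"
    using N_sum[of "\<lambda>b. (x \<bullet> b) *\<^sub>R b" Basis] by (simp add: N_scaleR)
  also have "\<dots> \<le> (\<Sum>b\<in>Basis. norm x * N b)"
    by (intro sum_mono mult_right_mono) (auto simp: Basis_le_norm)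
  also have "\<dots> \<le> (1 + (\<Sum>b\<in>Basis. N b)) * norm x"
    by (simp add: sum_distrib_left algebra_simps)
  finally show "N x \<le> (1 + (\<Sum>b\<in>Basis. N b)) * norm x" .
qed

lemma continuous_on_N: "continuous_on A N"
proof -
  obtain C where C: "C > 0" "\<And>x. N x \<le> C * norm x"
    using N_le_norm by blast
  have "dist (N x) (N y) \<le> C * dist x y" for x y
    using N_triangle[of "x - y" y] N_triangle[of "y - x" x] N_minus_commute[of x y] C(2)[of "x - y"]
    by (simp add: dist_norm)
  then have "C-lipschitz_on A N"
    using C(1) by (auto simp: lipschitz_on_def)
  then show ?thesis
    by (rule lipschitz_on_continuous_on)
qed

lemma norm_le_N:
  obtains c where "c > 0" "\<And>x. norm x \<le> c * N x"
proof -
  obtain b :: 'a where "b \<in> Basis" by (metis SOME_Basis)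
  then have "sphere (0::'a) 1 \<noteq> {}"
    by (metis norm_Basis dist_0_norm mem_sphere empty_iff)
  then obtain z where z: "z \<in> sphere 0 1" "\<And>y. y \<in> sphere 0 1 \<Longrightarrow> N z \<le> N y"
    using continuous_attains_inf[OF compact_sphere _ continuous_on_N] by blast
  have pos: "N z > 0"
    using z(1) N_eq_0_iff[of z] N_nonneg[of z] by (metis less_eq_real_def dist_0_norm mem_sphere norm_zero zero_neq_one)
  show ?thesis
  proof
    show "1 / N z > 0" using pos by simp
    fix x
    show "norm x \<le> 1 / N z * N x"
    proof (cases "x = 0")
      case False
      then have "N z \<le> N ((1 / norm x) *\<^sub>R x)"
        by (intro z(2)) simp
      then show ?thesis
        using False pos by (simp add: N_scaleR field_simps)
    qed simp
  qed
qed

lemma dual_norm_bdd: "bdd_above {w \<bullet> x |x. N x \<le> 1}"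
proof -
  obtain c where c: "c > 0" "\<And>x. norm x \<le> c * N x"
    using norm_le_N by blast
  have "w \<bullet> x \<le> norm w * c" if "N x \<le> 1" for x
  proof -
    have "w \<bullet> x \<le> norm w * norm x" by (rule norm_cauchy_schwarz)
    also have "norm x \<le> c * 1"
      using c(2)[of x] mult_left_mono[OF that, of c] c(1) by linarith
    finally show ?thesis by (simp add: mult_left_mono)
  qed
  then show ?thesis by (auto intro!: bdd_aboveI[of _ "norm w * c"])
qed

lemma inner_le_dual_norm_unit: "N x \<le> 1 \<Longrightarrow> w \<bullet> x \<le> dual_norm N w"
  unfolding dual_norm_def by (rule cSup_upper) (auto intro: dual_norm_bdd)

lemma dual_norm_leI: "(\<And>x. N x \<le> 1 \<Longrightarrow> w \<bullet> x \<le> B) \<Longrightarrow> dual_norm N w \<le> B"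
  unfolding dual_norm_def by (rule cSup_least) (auto intro: exI[of _ 0])

lemma dual_norm_nonneg [simp]: "0 \<le> dual_norm N w"
  using inner_le_dual_norm_unit[of 0 w] by simp

lemma inner_le_dual_norm: "w \<bullet> x \<le> dual_norm N w * N x"
proof (cases "x = 0")
  case False
  then have pos: "N x > 0" using N_nonneg[of x] N_eq_0_iff[of x] by linarith
  have "w \<bullet> ((1 / N x) *\<^sub>R x) \<le> dual_norm N w"
    using pos by (intro inner_le_dual_norm_unit) (simp add: N_scaleR)
  then show ?thesis using pos by (simp add: field_simps)
qed simp

lemma dual_norm_triangle: "dual_norm N (v + w) \<le> dual_norm N v + dual_norm N w"
  by (rule dual_norm_leI) (simp add: inner_add_left add_mono inner_le_dual_norm_unit)

lemma dual_norm_minus [simp]: "dual_norm N (- w) = dual_norm N w"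
proof -
  have "dual_norm N (- v) \<le> dual_norm N v" for v
    by (rule dual_norm_leI) (use inner_le_dual_norm_unit[of "- x" v for x] in auto)
  from this[of w] this[of "- w"] show ?thesis by simp
qed

lemma dual_norm_diff: "dual_norm N (v - w) \<le> dual_norm N v + dual_norm N w"
  using dual_norm_triangle[of v "- w"] by simp

lemma dual_norm_scaleR_le: "0 \<le> c \<Longrightarrow> dual_norm N (c *\<^sub>R w) \<le> c * dual_norm N w"
  by (rule dual_norm_leI) (simp add: mult_left_mono inner_le_dual_norm_unit)

lemma dual_norm_zero [simp]: "dual_norm N 0 = 0"
  using dual_norm_scaleR_le[of 0 0] dual_norm_nonneg[of 0] by simp

lemma dual_norm_scaleR: "dual_norm N (c *\<^sub>R w) = \<bar>c\<bar> * dual_norm N w"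
proof -
  have *: "dual_norm N (c *\<^sub>R w) = c * dual_norm N w" if "0 \<le> c" for c w
  proof (cases "c = 0")
    case False
    then have "dual_norm N ((1/c) *\<^sub>R c *\<^sub>R w) \<le> (1/c) * dual_norm N (c *\<^sub>R w)"
      using that by (intro dual_norm_scaleR_le) simp
    then have "c * dual_norm N w \<le> dual_norm N (c *\<^sub>R w)"
      using that False by (simp add: field_simps)
    then show ?thesis using dual_norm_scaleR_le[OF that, of w] by simp
  qed simp
  show ?thesis
    using *[of c w] *[of "- c" w] dual_norm_minus[of "c *\<^sub>R w"] by (cases "c \<ge> 0") auto
qed

lemma inner_le_Young: "w \<bullet> x \<le> 1/2 * (dual_norm N w)\<^sup>2 + 1/2 * (N x)\<^sup>2"
  using inner_le_dual_norm[of w x] sum_squares_bound[of "dual_norm N w" "N x"] by simp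

end

section \<open>Finitely supported expectations\<close>

lemma square_add_le:
  fixes a b \<theta> :: real
  assumes "\<theta> > 0"
  shows "(a + b)\<^sup>2 \<le> (1 + \<theta>) * a\<^sup>2 + (1 + 1 / \<theta>) * b\<^sup>2"
proof -
  have "(1 + \<theta>) * a\<^sup>2 + (1 + 1 / \<theta>) * b\<^sup>2 - (a + b)\<^sup>2 = (\<theta> * a - b)\<^sup>2 / \<theta>"
    using assms by (simp add: power2_eq_square field_simps)
  also have "\<dots> \<ge> 0" using assms by simp
  finally show ?thesis by simp
qed

lemma expectation_mono_pmf:
  fixes h k :: "'b \<Rightarrow> real"
  assumes "finite (set_pmf p)" "\<And>x. x \<in> set_pmf p \<Longrightarrow> h x \<le> k x"
  shows "measure_pmf.expectation p h \<le> measure_pmf.expectation p k"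
  using assms by (intro integral_mono_AE integrable_measure_pmf_finite) (auto simp: AE_measure_pmf_iff)

lemma expectation_bind_pmf:
  fixes h :: "'c \<Rightarrow> real"
  assumes "finite (set_pmf p)" "\<And>x. x \<in> set_pmf p \<Longrightarrow> finite (set_pmf (q x))"
  shows "measure_pmf.expectation (bind_pmf p q) h =
         measure_pmf.expectation p (\<lambda>x. measure_pmf.expectation (q x) h)"
proof -
  have "measure_pmf.expectation (bind_pmf p q) h =
      (\<Sum>a\<in>set_pmf p. pmf p a *\<^sub>R measure_pmf.expectation (q a) h)"
    using assms by (intro pmf_expectation_bind) auto
  also have "\<dots> = measure_pmf.expectation p (\<lambda>x. measure_pmf.expectation (q x) h)"
    using assms by (subst integral_measure_pmf[of "set_pmf p"]) auto
  finally show ?thesis .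
qed

lemma finite_set_replicate_pmf:
  assumes "finite (set_pmf p)"
  shows "finite (set_pmf (replicate_pmf n p))"
proof (rule finite_subset)
  show "set_pmf (replicate_pmf n p) \<subseteq> {xs. set xs \<subseteq> set_pmf p \<and> length xs = n}"
    by (auto simp: set_replicate_pmf)
qed (rule finite_lists_length_eq[OF assms])

lemma expectation_replicate_pmf_Suc:
  fixes h :: "'b list \<Rightarrow> real"
  assumes "finite (set_pmf p)"
  shows "measure_pmf.expectation (replicate_pmf (Suc n) p) h =
    measure_pmf.expectation p (\<lambda>x. measure_pmf.expectation (replicate_pmf n p) (\<lambda>xs. h (x # xs)))"
proof -
  have "replicate_pmf (Suc n) p = bind_pmf p (\<lambda>x. map_pmf ((#) x) (replicate_pmf n p))"
    by (simp add: map_pmf_def)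
  then show ?thesis
    using assms finite_set_replicate_pmf[OF assms, of n]
    by (simp add: expectation_bind_pmf del: replicate_pmf.simps)
qed

text \<open>The reason why a batch estimate is unbiased.\<close>
lemma expectation_sum_list_replicate_pmf:
  fixes Y :: "'b \<Rightarrow> 'a::euclidean_space"
  assumes fin: "finite (set_pmf p)"
  shows "measure_pmf.expectation (replicate_pmf n p) (\<lambda>B. u \<bullet> (\<Sum>\<xi>\<leftarrow>B. Y \<xi>)) =
    real n * (u \<bullet> measure_pmf.expectation p Y)"
proof (induction n)
  case (Suc n)
  have int: "integrable p Y'" for Y' :: "'b \<Rightarrow> 'c::{banach, second_countable_topology}"
    by (intro integrable_measure_pmf_finite fin)
  have int': "integrable (replicate_pmf n p) Y'" for Y' :: "'b list \<Rightarrow> real"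
    by (intro integrable_measure_pmf_finite finite_set_replicate_pmf fin)
  show ?case
    by (simp add: expectation_replicate_pmf_Suc[OF fin] inner_add_right int int' Suc.IH
        algebra_simps del: replicate_pmf.simps)
qed simp

section \<open>Kernels of Bregman distances and their conjugates\<close>

lemma pcl_on_edom_subset: "pcl_on K h \<Longrightarrow> edom h \<subseteq> K"
  by (force simp: pcl_on_def edom_def)

lemma pcl_on_eq_real: "pcl_on K h \<Longrightarrow> x \<in> edom h \<Longrightarrow> h x = ereal (real_of_ereal (h x))"
  by (cases "h x") (auto simp: pcl_on_def proper_fun_def edom_def)

lemma pcl_on_convex_combination:
  assumes h: "pcl_on K h" and "x \<in> edom h" "y \<in> edom h" "0 < t" "t < 1"
  shows "(1 - t) *\<^sub>R x + t *\<^sub>R y \<in> edom h"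
    and "real_of_ereal (h ((1 - t) *\<^sub>R x + t *\<^sub>R y))
      \<le> (1 - t) * real_of_ereal (h x) + t * real_of_ereal (h y)"
proof -
  have "h ((1 - t) *\<^sub>R x + t *\<^sub>R y) \<le> ereal (1 - t) * h x + ereal t * h y"
    using assms by (simp add: pcl_on_def convex_fun_def)
  also have "\<dots> = ereal ((1 - t) * real_of_ereal (h x) + t * real_of_ereal (h y))"
    using pcl_on_eq_real[OF h] assms by (metis plus_ereal.simps(1) times_ereal.simps(1))
  finally have le: "h ((1 - t) *\<^sub>R x + t *\<^sub>R y)
      \<le> ereal ((1 - t) * real_of_ereal (h x) + t * real_of_ereal (h y))" .
  then show mem: "(1 - t) *\<^sub>R x + t *\<^sub>R y \<in> edom h"
    unfolding edom_def by (auto intro: le_less_trans[OF le])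
  show "real_of_ereal (h ((1 - t) *\<^sub>R x + t *\<^sub>R y))
      \<le> (1 - t) * real_of_ereal (h x) + t * real_of_ereal (h y)"
    using le pcl_on_eq_real[OF h mem] by (metis ereal_less_eq(3))
qed

locale bregman_kernel = finite_dim_norm N
  for N :: "'a::euclidean_space \<Rightarrow> real" +
  fixes K :: "'a set" and f g :: "'a \<Rightarrow> ereal"
  assumes generator: "bregman_generator N K g f"
    and dom_subdiff_nonempty: "dom_subdiff f \<noteq> {}"
begin

abbreviation fr :: "'a \<Rightarrow> real" where
  "fr x \<equiv> real_of_ereal (f x)"

lemma pcl: "pcl_on K f"
  using generator by (simp add: bregman_generator_def)

lemmas edom_subset = pcl_on_edom_subset[OF pcl]

lemma dom_subdiff_subset: "dom_subdiff f \<subseteq> edom f"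
  by (auto simp: dom_subdiff_def)

lemmas f_eq_fr = pcl_on_eq_real[OF pcl]

lemma convex_combination_edom:
  assumes "x \<in> edom f" "y \<in> edom f" "0 < t" "t < 1"
  shows "(1 - t) *\<^sub>R x + t *\<^sub>R y \<in> edom f"
    and "fr ((1 - t) *\<^sub>R x + t *\<^sub>R y) \<le> (1 - t) * fr x + t * fr y"
  using pcl_on_convex_combination[OF pcl assms] by auto

lemma convex_edom: "convex (edom f)"
proof (rule convexI)
  fix x y u v
  assume *: "x \<in> edom f" "y \<in> edom f" and uv: "0 \<le> u" "0 \<le> v" "u + v = (1::real)"
  consider "u = 0" "v = 1" | "u = 1" "v = 0" | "0 < v" "v < 1" using uv by fastforce
  then show "u *\<^sub>R x + v *\<^sub>R y \<in> edom f"
  proof cases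
    case 3
    then have "u = 1 - v" using uv by simp
    with 3 convex_combination_edom(1)[OF *, of v] show ?thesis by simp
  qed (use * in auto)
qed

lemma segment_edom:
  assumes "x \<in> edom f" "y \<in> edom f" "0 \<le> t" "t \<le> 1"
  shows "x + t *\<^sub>R (y - x) \<in> edom f"
proof -
  have "x + t *\<^sub>R (y - x) = (1 - t) *\<^sub>R x + t *\<^sub>R y" by (simp add: algebra_simps)
  then show ?thesis using convexD_alt[OF convex_edom assms(1,2)] assms(3,4) by simp
qed

lemma has_grad_grad:
  assumes "x \<in> dom_subdiff f"
  shows "has_grad f x (grad f x)"
proof -
  have "\<exists>!v. has_grad f x v"
    using generator assms by (auto simp: bregman_generator_def grad_differentiable_def)
  then show ?thesis unfolding grad_def by (rule theI')
qed

lemma strong_convexity: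
  assumes "x \<in> edom f" "y \<in> dom_subdiff f"
  shows "fr y + grad f y \<bullet> (x - y) + 1/2 * (N (x - y))\<^sup>2 \<le> fr x"
proof -
  have "f y + ereal (grad f y \<bullet> (x - y)) + ereal (1/2 * (N (x - y))\<^sup>2) \<le> f x"
    using generator assms by (simp add: bregman_generator_def)
  then show ?thesis
    using assms dom_subdiff_subset f_eq_fr[of x] f_eq_fr[of y]
    by (metis ereal_less_eq(3) plus_ereal.simps(1) subsetD)
qed

text \<open>Outside the effective domain the subgradient inequality is trivial, so real-valued inequalities on
  the domain suffice.\<close>
lemma dom_subdiffI:
  assumes "x \<in> edom f" "\<And>y. y \<in> edom f \<Longrightarrow> fr x + u \<bullet> (y - x) \<le> fr y"
  shows "x \<in> dom_subdiff f"
proof -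
  have "f x + ereal (u \<bullet> (y - x)) \<le> f y" for y
  proof (cases "y \<in> edom f")
    case True
    then show ?thesis using assms(2)[OF True] f_eq_fr[OF True] f_eq_fr[OF assms(1)]
      by (metis ereal_less_eq(3) plus_ereal.simps(1))
  next
    case False
    then show ?thesis by (simp add: edom_def)
  qed
  then have "u \<in> subdifferential f x"
    using f_eq_fr[OF assms(1)] unfolding subdifferential_def
    by (cases "f x") auto
  then show ?thesis using assms(1) by (auto simp: dom_subdiff_def)
qed

text \<open>The gradient is only a derivative relative to the effective domain, so one may not vary a point in
  every direction. Moving towards another point of the domain is allowed, and a linear lower bound on
  the increments along such a segment passes to the derivative. All first-order optimality
  conditions below are instances.\<close>
lemma directional_derivative_ge:
  assumes x: "x \<in> dom_subdiff f" and y: "y \<in> edom f"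
    and slope: "\<And>t. 0 < t \<Longrightarrow> t < 1 \<Longrightarrow> t * \<kappa> \<le> fr (x + t *\<^sub>R (y - x)) - fr x"
  shows "\<kappa> \<le> grad f x \<bullet> (y - x)"
proof -
  define p where "p t = x + t *\<^sub>R (y - x)" for t :: real
  have "p ` {0..1} \<subseteq> edom f"
    using segment_edom[of x y] x y dom_subdiff_subset by (auto simp: p_def)
  then have "(fr has_derivative (\<lambda>d. grad f x \<bullet> d)) (at (p 0) within p ` {0..1})"
    using has_grad_grad[OF x] by (auto simp: has_grad_def p_def intro: has_derivative_subset)
  moreover have "(p has_derivative (\<lambda>t. t *\<^sub>R (y - x))) (at 0 within {0..1})"
    unfolding p_def by (auto intro!: derivative_eq_intros)
  ultimately have "((\<lambda>t. fr (p t)) has_derivative (\<lambda>t. grad f x \<bullet> (t *\<^sub>R (y - x)))) (at 0 within {0..1})"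
    by (rule has_derivative_in_compose[rotated])
  then have "((\<lambda>t. fr (p t)) has_field_derivative grad f x \<bullet> (y - x)) (at 0 within {0..1})"
    unfolding has_field_derivative_def
    by (rule has_derivative_eq_rhs) (simp add: fun_eq_iff)
  then have "((\<lambda>t. (fr (p t) - fr x) / t) \<longlongrightarrow> grad f x \<bullet> (y - x)) (at_right 0)"
    by (simp add: has_field_derivative_iff p_def at_within_Icc_at_right)
  moreover have "eventually (\<lambda>t. \<kappa> \<le> (fr (p t) - fr x) / t) (at_right 0)"
    unfolding eventually_at_right_field
    using slope by (intro exI[of _ 1]) (auto simp: p_def field_simps)
  ultimately show ?thesis
    by (rule tendsto_lowerbound) simp
qed

text \<open>Strong convexity at a single point of \<open>dom_subdiff f\<close> makes \<open>f\<close> minus a linear function grow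
  quadratically; a minimising sequence is therefore bounded, and lower semicontinuity makes any of
  its limit points a minimiser.\<close>
lemma linear_tilt_attained:
  obtains z where "z \<in> edom f" "\<And>y. y \<in> edom f \<Longrightarrow> fr z - u \<bullet> z \<le> fr y - u \<bullet> y"
proof -
  define h where "h y = fr y - u \<bullet> y" for y
  obtain x where x: "x \<in> dom_subdiff f" using dom_subdiff_nonempty by blast
  define w where "w = u - grad f x"
  have growth: "1/4 * (N (y - x))\<^sup>2 \<le> h y - h x + (dual_norm N w)\<^sup>2" if "y \<in> edom f" for y
  proof -
    have "w \<bullet> (y - x) \<le> (dual_norm N w)\<^sup>2 + 1/4 * (N (y - x))\<^sup>2"
      using inner_le_dual_norm[of w "y - x"]
        sum_squares_bound[of "2 * dual_norm N w" "N (y - x)"] by (simp add: power2_eq_square)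
    moreover have "1/2 * (N (y - x))\<^sup>2 \<le> h y - h x + w \<bullet> (y - x)"
      using strong_convexity[OF that x] by (simp add: h_def w_def algebra_simps)
    ultimately show ?thesis by simp
  qed
  have bdd: "bdd_below (h ` edom f)"
  proof (rule bdd_belowI2)
    fix y assume "y \<in> edom f"
    then show "h x - (dual_norm N w)\<^sup>2 \<le> h y"
      using growth[of y] zero_le_power2[of "N (y - x)"] by linarith
  qed
  define m where "m = Inf (h ` edom f)"
  have ne: "h ` edom f \<noteq> {}" using x dom_subdiff_subset by auto
  have "\<exists>y \<in> edom f. h y < m + 1 / real (Suc n)" for n
    using cInf_lessD[OF ne, of "m + 1 / real (Suc n)"] by (auto simp: m_def)
  then obtain y where y: "\<And>n. y n \<in> edom f" "\<And>n. h (y n) < m + 1 / real (Suc n)"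
    by metis
  have "bounded (range y)"
  proof -
    obtain c where c: "c > 0" "\<And>x. norm x \<le> c * N x" using norm_le_N by blast
    define B where "B = 4 * (m + 1 - h x + (dual_norm N w)\<^sup>2)"
    have "norm (y n - x) \<le> c * sqrt B" for n
    proof -
      have "1 / real (Suc n) \<le> 1" by simp
      then have "(N (y n - x))\<^sup>2 \<le> B"
        using growth[OF y(1)[of n]] y(2)[of n] unfolding B_def by argo
      then have "N (y n - x) \<le> sqrt B" by (rule real_le_rsqrt)
      then show ?thesis using c(1) c(2)[of "y n - x"] by (meson dual_order.trans mult_left_mono less_imp_le)
    qed
    then have "range y \<subseteq> cball x (c * sqrt B)"
      by (auto simp: dist_norm norm_minus_commute)
    then show ?thesis by (rule bounded_subset[OF bounded_cball])
  qed
  then obtain l r where r: "strict_mono r" and lim: "(y \<circ> r) \<longlonglongrightarrow> l"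
    using bounded_imp_convergent_subsequence by blast
  have lsc: "f l \<le> Liminf (at l) f"
    using generator by (simp add: bregman_generator_def pcl_on_def lsc_fun_def)
  have "f l \<le> ereal (m + u \<bullet> l)"
  proof (rule ccontr)
    assume "\<not> f l \<le> ereal (m + u \<bullet> l)"
    then obtain c where c: "ereal (m + u \<bullet> l) < ereal c" "ereal c < f l"
      using ereal_dense2[of "ereal (m + u \<bullet> l)" "f l"] by (auto simp: not_le)
    have "eventually (\<lambda>z. ereal c < f z) (at l)"
      using lsc c(2) unfolding le_Liminf_iff by blast
    then have "eventually (\<lambda>z. ereal c < f z) (nhds l)"
      using c(2) eventually_nhds_conv_at by blast
    then have "eventually (\<lambda>n. ereal c < f ((y \<circ> r) n)) sequentially"
      using lim by (rule eventually_compose_filterlim)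
    then have "eventually (\<lambda>n. c \<le> m + 1 / real (Suc (r n)) + u \<bullet> (y \<circ> r) n) sequentially"
    proof (rule eventually_mono)
      fix n assume "ereal c < f ((y \<circ> r) n)"
      then have "c < fr (y (r n))" using f_eq_fr[OF y(1)[of "r n"]] by (metis comp_apply ereal_less(2) less_ereal.simps(1))
      then show "c \<le> m + 1 / real (Suc (r n)) + u \<bullet> (y \<circ> r) n"
        using y(2)[of "r n"] by (simp add: h_def)
    qed
    moreover have "(\<lambda>n. m + 1 / real (Suc (r n)) + u \<bullet> (y \<circ> r) n) \<longlonglongrightarrow> m + 0 + u \<bullet> l"
      by (intro tendsto_intros lim LIMSEQ_subseq_LIMSEQ[OF LIMSEQ_Suc[OF lim_1_over_n] r, unfolded comp_def])
    ultimately have "c \<le> m + 0 + u \<bullet> l"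
      by (intro tendsto_lowerbound[where F = sequentially]) auto
    with c(1) show False by simp
  qed
  then have l: "l \<in> edom f" by (auto simp: edom_def intro: le_less_trans)
  with \<open>f l \<le> ereal (m + u \<bullet> l)\<close> have "h l \<le> m"
    using f_eq_fr[OF l] by (metis h_def ereal_less_eq(3) diff_le_eq)
  moreover have "m \<le> h y" if "y \<in> edom f" for y
    unfolding m_def using bdd that by (intro cInf_lower) auto
  ultimately have "h l \<le> h y" if "y \<in> edom f" for y
    using that by (meson order_trans)
  then show ?thesis using that l by (simp add: h_def)
qed

text \<open>A minimiser of \<open>f\<close> minus the linear function \<open>u\<close> has \<open>u\<close> as a subgradient, hence it lies in
  \<open>dom_subdiff f\<close> and has a gradient. On the boundary of the domain this gradient may differ from
  \<open>u\<close>, but only by an element of the normal cone (second property); that is enough to combine with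
  strong convexity at the minimiser (third property).\<close>
lemma linear_tilt_minimiser:
  obtains z where "z \<in> dom_subdiff f"
    "\<And>y. y \<in> edom f \<Longrightarrow> u \<bullet> (y - z) \<le> grad f z \<bullet> (y - z)"
    "\<And>y. y \<in> edom f \<Longrightarrow> u \<bullet> y - fr y + 1/2 * (N (y - z))\<^sup>2 \<le> u \<bullet> z - fr z"
proof -
  obtain z where z: "z \<in> edom f" "\<And>y. y \<in> edom f \<Longrightarrow> fr z - u \<bullet> z \<le> fr y - u \<bullet> y"
    using linear_tilt_attained by blast
  have mem: "z \<in> dom_subdiff f"
    using z by (intro dom_subdiffI[of z u]) (auto simp: algebra_simps)
  have dir: "u \<bullet> (y - z) \<le> grad f z \<bullet> (y - z)" if y: "y \<in> edom f" for y
  proof (rule directional_derivative_ge[OF mem y])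
    fix t :: real assume "0 < t" "t < 1"
    then show "t * (u \<bullet> (y - z)) \<le> fr (z + t *\<^sub>R (y - z)) - fr z"
      using z(2)[OF segment_edom[OF z(1) y, of t]] by (simp add: inner_add_right)
  qed
  show ?thesis
  proof (rule that[OF mem dir])
    fix y assume y: "y \<in> edom f"
    show "u \<bullet> y - fr y + 1/2 * (N (y - z))\<^sup>2 \<le> u \<bullet> z - fr z"
      using strong_convexity[OF y mem] dir[OF y] by (simp add: inner_diff_right)
  qed
qed

definition tilt :: "'a \<Rightarrow> 'a" where
  "tilt u = (SOME z. z \<in> dom_subdiff f \<and>
     (\<forall>y \<in> edom f. u \<bullet> (y - z) \<le> grad f z \<bullet> (y - z)) \<and>
     (\<forall>y \<in> edom f. u \<bullet> y - fr y + 1/2 * (N (y - z))\<^sup>2 \<le> u \<bullet> z - fr z))"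

text \<open>The Fenchel conjugate of \<open>f\<close>; the supremum is attained at \<open>tilt u\<close>, which is the gradient of the
  conjugate.\<close>
definition convex_conj :: "'a \<Rightarrow> real" where
  "convex_conj u = u \<bullet> tilt u - fr (tilt u)"

lemma tilt_properties:
  shows "tilt u \<in> dom_subdiff f"
    and "y \<in> edom f \<Longrightarrow> u \<bullet> (y - tilt u) \<le> grad f (tilt u) \<bullet> (y - tilt u)"
    and "y \<in> edom f \<Longrightarrow> u \<bullet> y - fr y + 1/2 * (N (y - tilt u))\<^sup>2 \<le> convex_conj u"
proof -
  have "\<exists>z. z \<in> dom_subdiff f \<and>
     (\<forall>y \<in> edom f. u \<bullet> (y - z) \<le> grad f z \<bullet> (y - z)) \<and>
     (\<forall>y \<in> edom f. u \<bullet> y - fr y + 1/2 * (N (y - z))\<^sup>2 \<le> u \<bullet> z - fr z)"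
    using linear_tilt_minimiser[of u] by metis
  from someI_ex[OF this, folded tilt_def]
  show "tilt u \<in> dom_subdiff f"
    and "y \<in> edom f \<Longrightarrow> u \<bullet> (y - tilt u) \<le> grad f (tilt u) \<bullet> (y - tilt u)"
    and "y \<in> edom f \<Longrightarrow> u \<bullet> y - fr y + 1/2 * (N (y - tilt u))\<^sup>2 \<le> convex_conj u"
    by (auto simp: convex_conj_def)
qed

text \<open>Duality between strong convexity and smoothness: the maximiser for \<open>u + v\<close> loses
  half the squared distance to \<open>tilt u\<close> when it is used at \<open>u\<close>, and Young's inequality pays for
  the displacement with this loss.\<close>
lemma convex_conj_smooth: "convex_conj (u + v) \<le> convex_conj u + tilt u \<bullet> v + 1/2 * (dual_norm N v)\<^sup>2"
proof -
  have "tilt (u + v) \<in> edom f" using tilt_properties(1) dom_subdiff_subset by auto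
  from tilt_properties(3)[OF this, of u] inner_le_Young[of v "tilt (u + v) - tilt u"]
  show ?thesis
    unfolding convex_conj_def[of "u + v"] by (simp add: inner_add_left inner_diff_right inner_commute)
qed

lemma convex_conj_grad:
  assumes x: "x \<in> dom_subdiff f"
  shows "tilt (grad f x) = x" and "convex_conj (grad f x) = grad f x \<bullet> x - fr x"
proof -
  have mem: "tilt (grad f x) \<in> edom f" using tilt_properties(1) dom_subdiff_subset by auto
  have "x \<in> edom f" using x dom_subdiff_subset by auto
  from tilt_properties(3)[OF this, of "grad f x"] strong_convexity[OF mem x]
  have "1/2 * (N (tilt (grad f x) - x))\<^sup>2 + 1/2 * (N (x - tilt (grad f x)))\<^sup>2 \<le> 0"
    by (simp add: convex_conj_def inner_diff_right)
  then have "(N (x - tilt (grad f x)))\<^sup>2 \<le> 0"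
    using zero_le_power2[of "N (tilt (grad f x) - x)"] by linarith
  then show "tilt (grad f x) = x" by simp
  then show "convex_conj (grad f x) = grad f x \<bullet> x - fr x" by (simp add: convex_conj_def)
qed

text \<open>The Bregman distance of the conjugate from \<open>grad f x\<close> to \<open>grad f x + w\<close>. It plays the role of
  half the squared dual norm of \<open>w\<close>, but unlike the dual norm it is smooth, so that variances of
  independent sums add up.\<close>
definition dual_bregman :: "'a \<Rightarrow> 'a \<Rightarrow> real" where
  "dual_bregman x w = convex_conj (grad f x + w) - convex_conj (grad f x) - x \<bullet> w"

lemma dual_bregman_smooth:
  "dual_bregman x (w + v) \<le>
     dual_bregman x w + (tilt (grad f x + w) - x) \<bullet> v + 1/2 * (dual_norm N v)\<^sup>2"
  using convex_conj_smooth[of "grad f x + w" v]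
  by (simp add: dual_bregman_def add.assoc inner_add_right inner_diff_left)

lemma dual_bregman_le:
  "x \<in> dom_subdiff f \<Longrightarrow> dual_bregman x w \<le> 1/2 * (dual_norm N w)\<^sup>2"
  using convex_conj_smooth[of "grad f x" w] convex_conj_grad(1)[of x] by (simp add: dual_bregman_def)

lemma dual_bregman_ge:
  assumes "x \<in> dom_subdiff f"
  shows "1/2 * (N (tilt (grad f x + w) - x))\<^sup>2 \<le> dual_bregman x w"
proof -
  have "x \<in> edom f" using assms dom_subdiff_subset by auto
  from tilt_properties(3)[OF this, of "grad f x + w"] show ?thesis
    by (simp add: dual_bregman_def convex_conj_grad(2)[OF assms] inner_add_left inner_add_right inner_commute N_minus_commute[of x])
qed

text \<open>The real-valued form of \<open>bregman f\<close>, meaningful on the effective domain.\<close>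
definition breg :: "'a \<Rightarrow> 'a \<Rightarrow> real" where
  "breg y x = fr y - fr x - grad f x \<bullet> (y - x)"

lemma bregman_eq_breg:
  assumes "y \<in> edom f" "x \<in> dom_subdiff f"
  shows "bregman f y x = ereal (breg y x)"
  using f_eq_fr[OF assms(1)] f_eq_fr[of x] assms(2) dom_subdiff_subset
  unfolding bregman_def breg_def by (metis ereal_minus(1) subsetD)

lemma breg_ge:
  "y \<in> edom f \<Longrightarrow> x \<in> dom_subdiff f \<Longrightarrow> 1/2 * (N (y - x))\<^sup>2 \<le> breg y x"
  using strong_convexity[of y x] by (simp add: breg_def)

lemma Fenchel_Young_breg:
  assumes "x \<in> dom_subdiff f" "y \<in> edom f"
  shows "w \<bullet> (y - x) \<le> breg y x + dual_bregman x w"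
proof -
  have "(grad f x + w) \<bullet> y - fr y \<le> convex_conj (grad f x + w)"
    using tilt_properties(3)[OF assms(2), of "grad f x + w"]
      zero_le_power2[of "N (y - tilt (grad f x + w))"] by linarith
  then show ?thesis
    by (simp add: breg_def dual_bregman_def convex_conj_grad(2)[OF assms(1)] inner_add_left
      inner_add_right inner_diff_right inner_commute)
qed

text \<open>If the domain had empty interior, it would lie in a hyperplane, and adding a normal vector to a
  gradient would give a second one, against uniqueness. At an interior point the epigraph has a
  supporting hyperplane, which is not vertical and so is the graph of a subgradient.\<close>
lemma interior_dom_subdiff_point:
  obtains x where "x \<in> dom_subdiff f" "x \<in> interior (edom f)"
proof -
  obtain x0 where x0: "x0 \<in> dom_subdiff f" using dom_subdiff_nonempty by blast
  have "interior (edom f) \<noteq> {}"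
  proof
    assume "interior (edom f) = {}"
    then obtain a c where a: "a \<noteq> 0" "edom f \<subseteq> {x. a \<bullet> x = c}"
      using empty_interior_subset_hyperplane[OF convex_edom] by blast
    have "has_grad f x0 (grad f x0 + a)"
    proof -
      have *: "a \<bullet> (y - x0) = 0" if "y \<in> edom f" for y
        using a(2) that x0 dom_subdiff_subset by (auto simp: inner_diff_right)
      have "((\<lambda>y. (1 / norm (y - x0)) *\<^sub>R (fr y - (fr x0 + grad f x0 \<bullet> (y - x0)))) \<longlongrightarrow> 0) (at x0 within edom f)"
        using has_grad_grad[OF x0] by (simp add: has_grad_def has_derivative_within)
      moreover have "eventually (\<lambda>y. (1 / norm (y - x0)) *\<^sub>R (fr y - (fr x0 + grad f x0 \<bullet> (y - x0)))
          = (1 / norm (y - x0)) *\<^sub>R (fr y - (fr x0 + (grad f x0 + a) \<bullet> (y - x0)))) (at x0 within edom f)"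
        using * by (auto simp: eventually_at_filter inner_add_left)
      ultimately have "((\<lambda>y. (1 / norm (y - x0)) *\<^sub>R (fr y - (fr x0 + (grad f x0 + a) \<bullet> (y - x0)))) \<longlongrightarrow> 0) (at x0 within edom f)"
        by (rule Lim_transform_eventually)
      then show ?thesis
        by (simp add: has_grad_def has_derivative_within bounded_linear_inner_right)
    qed
    moreover have "\<exists>!v. has_grad f x0 v"
      using generator x0 by (auto simp: bregman_generator_def grad_differentiable_def)
    ultimately show False using has_grad_grad[OF x0] a(1) by (metis add_cancel_left_right)
  qed
  then obtain y where y: "y \<in> interior (edom f)" by blast
  then have y': "y \<in> edom f" using interior_subset by auto
  define E where "E = {(z, t). z \<in> edom f \<and> fr z < t}"
  have "convex E"
  proof (rule convexI)
    fix p q :: "'a \<times> real" and u v :: real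
    assume pq: "p \<in> E" "q \<in> E" and uv: "0 \<le> u" "0 \<le> v" "u + v = 1"
    obtain z t z' t' where [simp]: "p = (z, t)" "q = (z', t')" by (metis surj_pair)
    have *: "z \<in> edom f" "fr z < t" "z' \<in> edom f" "fr z' < t'" using pq by (auto simp: E_def)
    consider "u = 0" "v = 1" | "u = 1" "v = 0" | "0 < v" "v < 1" "u = 1 - v" using uv by fastforce
    then show "u *\<^sub>R p + v *\<^sub>R q \<in> E"
    proof cases
      case 3
      have "fr ((1 - v) *\<^sub>R z + v *\<^sub>R z') \<le> (1 - v) * fr z + v * fr z'"
        using convex_combination_edom(2)[of z z' v] * 3 by simp
      also have "\<dots> < (1 - v) * t + v * t'"
        using * 3 by (intro add_strict_mono mult_strict_left_mono) auto
      finally show ?thesis using convex_combination_edom(1)[of z z' v] * 3 by (simp add: E_def)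
    qed (use * in \<open>auto simp: E_def\<close>)
  qed
  moreover have "E \<noteq> {}" "E \<inter> {(y, fr y)} = {}"
    using y' lt_ex gt_ex[of "fr y"] by (auto simp: E_def)
  ultimately obtain ac \<beta> where ac: "ac \<noteq> 0" "\<forall>p\<in>E. ac \<bullet> p \<le> \<beta>" "\<beta> \<le> ac \<bullet> (y, fr y)"
    using separating_hyperplane_sets[of E "{(y, fr y)}"] by auto
  obtain a c where [simp]: "ac = (a, c)" by (metis surj_pair)
  have sep: "a \<bullet> (z - y) + c * (t - fr y) \<le> 0" if "z \<in> edom f" "fr z < t" for z t
    using ac(2,3) that by (fastforce simp: E_def algebra_simps)
  have sep': "a \<bullet> (z - y) + c * (fr z - fr y) \<le> 0" if z: "z \<in> edom f" for z
  proof (rule tendsto_upperbound)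
    show "((\<lambda>t. a \<bullet> (z - y) + c * (t - fr y)) \<longlongrightarrow> a \<bullet> (z - y) + c * (fr z - fr y)) (at_right (fr z))"
      by (intro tendsto_intros)
    show "eventually (\<lambda>t. a \<bullet> (z - y) + c * (t - fr y) \<le> 0) (at_right (fr z))"
      using sep[OF z] by (auto simp: eventually_at_filter)
  qed simp
  have "c \<le> 0" using sep[OF y', of "fr y + 1"] by simp
  moreover have "c \<noteq> 0"
  proof
    assume "c = 0"
    then have "a \<noteq> 0" using ac(1) by (simp add: zero_prod_def)
    obtain e where e: "e > 0" "cball y e \<subseteq> edom f" using y mem_interior_cball by blast
    have "y + (e / norm a) *\<^sub>R a \<in> edom f"
      using e \<open>a \<noteq> 0\<close> by (intro subsetD[OF e(2)]) (simp add: dist_norm)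
    from sep'[OF this] \<open>c = 0\<close> have "(e / norm a) * (a \<bullet> a) \<le> 0"
      by simp
    moreover have "(e / norm a) * (a \<bullet> a) > 0"
      using e(1) \<open>a \<noteq> 0\<close> by simp
    ultimately show False by simp
  qed
  ultimately have c: "c < 0" by simp
  have "y \<in> dom_subdiff f"
  proof (rule dom_subdiffI[OF y'])
    fix z assume "z \<in> edom f"
    from sep'[OF this] c show "fr y + ((- 1 / c) *\<^sub>R a) \<bullet> (z - y) \<le> fr z"
      by (simp add: field_simps)
  qed
  with y show ?thesis using that by blast
qed

text \<open>The converse, up to the constant \<open>2 * Lf\<^sup>2\<close>, of the quadratic upper bound on \<open>dual_bregman\<close>. Near
  an interior point \<open>x\<close> a small \<open>w\<close> is realised as a difference of gradients: the maximiser
  \<open>z = tilt (grad f x + w)\<close> stays in the interior, where the normal cone is trivial, so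
  \<open>grad f z = grad f x + w\<close>. The Lipschitz bound on gradients then compares \<open>w\<close> with \<open>z - x\<close>.
  No bound for large \<open>w\<close> is claimed, because the Lipschitz bound says nothing outside the domain.\<close>
lemma dual_norm_le_dual_bregman_locally:
  assumes lip: "\<And>x y. x \<in> dom_subdiff f \<Longrightarrow> y \<in> dom_subdiff f \<Longrightarrow>
      dual_norm N (grad f x - grad f y) \<le> Lf * N (x - y)"
    and x: "x \<in> dom_subdiff f" "x \<in> interior (edom f)"
  obtains r where "r > 0"
    "\<And>w. dual_norm N w < r \<Longrightarrow> (dual_norm N w)\<^sup>2 \<le> 2 * Lf\<^sup>2 * dual_bregman x w"
proof -
  obtain e where e: "e > 0" "ball x e \<subseteq> edom f" using x(2) mem_interior by blast
  obtain c where c: "c > 0" "\<And>x. norm x \<le> c * N x" using norm_le_N by blast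
  have "(dual_norm N w)\<^sup>2 \<le> 2 * Lf\<^sup>2 * dual_bregman x w" if w: "dual_norm N w < e / c" for w
  proof -
    define z where "z = tilt (grad f x + w)"
    have z: "z \<in> dom_subdiff f" using tilt_properties(1) by (simp add: z_def)
    have "(N (z - x))\<^sup>2 \<le> (dual_norm N w)\<^sup>2"
      using dual_bregman_ge[OF x(1), of w] dual_bregman_le[OF x(1), of w] unfolding z_def by linarith
    then have "N (z - x) \<le> dual_norm N w" by (rule power2_le_imp_le) simp
    then have "c * N (z - x) \<le> c * dual_norm N w" using c(1) by simp
    also have "\<dots> < e" using w c(1) by (simp add: field_simps)
    finally have "c * N (z - x) < e" .
    then have "z \<in> ball x e" using c(2)[of "z - x"] by (simp add: dist_norm norm_minus_commute)
    then obtain r where r: "r > 0" "cball z r \<subseteq> edom f"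
      using e(2) open_ball[of x e] by (meson open_contains_cball subset_trans)
    have "grad f z = grad f x + w"
    proof (rule ccontr)
      define a where "a = grad f x + w - grad f z"
      assume "grad f z \<noteq> grad f x + w"
      then have a: "a \<noteq> 0" by (simp add: a_def)
      have "z + (r / norm a) *\<^sub>R a \<in> edom f"
        using r a by (intro subsetD[OF r(2)]) (simp add: dist_norm)
      from tilt_properties(2)[OF this, of "grad f x + w", folded z_def]
      moreover have "a \<bullet> v = (grad f x + w) \<bullet> v - grad f z \<bullet> v" for v
        by (simp add: a_def inner_diff_left)
      ultimately have "a \<bullet> ((r / norm a) *\<^sub>R a) \<le> 0"
        by (simp only: add_diff_cancel_left' diff_le_0_iff_le)
      then have "(r / norm a) * (a \<bullet> a) \<le> 0" by simp
      moreover have "(r / norm a) * (a \<bullet> a) > 0" using r(1) a by simp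
      ultimately show False by simp
    qed
    then have "dual_norm N w \<le> Lf * N (z - x)"
      using lip[OF z x(1)] by simp
    then have "(dual_norm N w)\<^sup>2 \<le> (Lf * N (z - x))\<^sup>2"
      by (intro power_mono) auto
    also have "\<dots> \<le> 2 * Lf\<^sup>2 * dual_bregman x w"
      using mult_left_mono[OF dual_bregman_ge[OF x(1), of w], of "2 * Lf\<^sup>2"]
      by (simp add: power_mult_distrib z_def)
    finally show ?thesis .
  qed
  then show ?thesis using that[of "e / c"] e(1) c(1) by simp
qed

end

section \<open>Second moments of batch means\<close>

context finite_dim_norm
begin

text \<open>One summand at a time: the linear term of the smoothness inequality vanishes in expectation because
  the new summand is centred and independent of the earlier ones, and only its quadratic term
  remains.\<close>
lemma expectation_smooth_centred_sum:
  fixes Y :: "'b \<Rightarrow> 'a" and \<psi> :: "'a \<Rightarrow> real" and G :: "'a \<Rightarrow> 'a"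
  assumes fin: "finite (set_pmf p)"
    and smooth: "\<And>u v. \<psi> (u + v) \<le> \<psi> u + G u \<bullet> v + 1/2 * (dual_norm N v)\<^sup>2"
    and centred: "measure_pmf.expectation p Y = 0"
  shows "measure_pmf.expectation (replicate_pmf n p) (\<lambda>B. \<psi> (u + (\<Sum>\<xi>\<leftarrow>B. Y \<xi>)))
    \<le> \<psi> u + real n / 2 * measure_pmf.expectation p (\<lambda>\<xi>. (dual_norm N (Y \<xi>))\<^sup>2)"
proof (induction n arbitrary: u)
  case (Suc n)
  let ?V = "measure_pmf.expectation p (\<lambda>\<xi>. (dual_norm N (Y \<xi>))\<^sup>2)"
  have int: "integrable p Z" for Z :: "'b \<Rightarrow> 'c::{banach, second_countable_topology}"
    by (intro integrable_measure_pmf_finite fin)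
  have "measure_pmf.expectation (replicate_pmf (Suc n) p) (\<lambda>B. \<psi> (u + (\<Sum>\<xi>\<leftarrow>B. Y \<xi>)))
      = measure_pmf.expectation p (\<lambda>\<eta>.
          measure_pmf.expectation (replicate_pmf n p) (\<lambda>B. \<psi> ((u + Y \<eta>) + (\<Sum>\<xi>\<leftarrow>B. Y \<xi>))))"
    by (simp add: expectation_replicate_pmf_Suc[OF fin] add.assoc del: replicate_pmf.simps)
  also have "\<dots> \<le> measure_pmf.expectation p (\<lambda>\<eta>. \<psi> (u + Y \<eta>) + real n / 2 * ?V)"
    by (intro expectation_mono_pmf fin Suc.IH)
  also have "\<dots> \<le> measure_pmf.expectation p (\<lambda>\<eta>. (\<psi> u + real n / 2 * ?V) + (G u \<bullet> Y \<eta> + 1/2 * (dual_norm N (Y \<eta>))\<^sup>2))"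
  proof (intro expectation_mono_pmf fin)
    fix \<eta> show "\<psi> (u + Y \<eta>) + real n / 2 * ?V \<le> (\<psi> u + real n / 2 * ?V) + (G u \<bullet> Y \<eta> + 1/2 * (dual_norm N (Y \<eta>))\<^sup>2)"
      using smooth[of u "Y \<eta>"] by simp
  qed
  also have "\<dots> = \<psi> u + real (Suc n) / 2 * ?V"
    by (simp add: int centred field_simps)
  finally show ?case .
qed simp

text \<open>For the Euclidean norm the second moment of a batch mean is the squared norm of the mean plus
  \<open>1/b\<close> times the variance. For a general norm the average of independent vectors need not be that
  small, but a function \<open>\<psi>\<close> that is smooth with respect to the dual norm and
  dominated by half its square still sees the factor \<open>1/b\<close>. Centring is done by
  hand and costs the constants 2 and 5/2 (for \<open>b \<ge> 2\<close>); for \<open>b = 1\<close> there is nothing to average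
  and the plain second moment is already within the bound.\<close>
lemma expectation_smooth_batch_mean:
  fixes Y :: "'b \<Rightarrow> 'a" and \<psi> :: "'a \<Rightarrow> real" and G :: "'a \<Rightarrow> 'a"
  assumes fin: "finite (set_pmf p)"
    and smooth: "\<And>u v. \<psi> (u + v) \<le> \<psi> u + G u \<bullet> v + 1/2 * (dual_norm N v)\<^sup>2"
    and le: "\<And>v. \<psi> v \<le> 1/2 * (dual_norm N v)\<^sup>2"
    and b: "b \<ge> 1"
  shows "measure_pmf.expectation (replicate_pmf b p) (\<lambda>B. \<psi> (c *\<^sub>R (1 / real b) *\<^sub>R (\<Sum>\<xi>\<leftarrow>B. Y \<xi>)))
    \<le> c\<^sup>2 / 2 * (2 * (dual_norm N (measure_pmf.expectation p Y))\<^sup>2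
        + 5/2 * measure_pmf.expectation p (\<lambda>\<xi>. (dual_norm N (Y \<xi>))\<^sup>2) / real b)"
proof -
  define \<mu> where "\<mu> = measure_pmf.expectation p Y"
  define V where "V = measure_pmf.expectation p (\<lambda>\<xi>. (dual_norm N (Y \<xi>))\<^sup>2)"
  have V: "V \<ge> 0" unfolding V_def by (rule Bochner_Integration.integral_nonneg) auto
  have int: "integrable p Z" for Z :: "'b \<Rightarrow> 'c::{banach, second_countable_topology}"
    by (intro integrable_measure_pmf_finite fin)
  show ?thesis
  proof (cases "b = 1")
    case True
    have "measure_pmf.expectation (replicate_pmf b p) (\<lambda>B. \<psi> (c *\<^sub>R (1 / real b) *\<^sub>R (\<Sum>\<xi>\<leftarrow>B. Y \<xi>)))
        = measure_pmf.expectation p (\<lambda>\<xi>. \<psi> (c *\<^sub>R Y \<xi>))"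
      using True by (simp add: expectation_replicate_pmf_Suc[OF fin, of 0, simplified])
    also have "\<dots> \<le> measure_pmf.expectation p (\<lambda>\<xi>. c\<^sup>2 / 2 * (dual_norm N (Y \<xi>))\<^sup>2)"
    proof (intro expectation_mono_pmf fin)
      fix \<xi> show "\<psi> (c *\<^sub>R Y \<xi>) \<le> c\<^sup>2 / 2 * (dual_norm N (Y \<xi>))\<^sup>2"
        using le[of "c *\<^sub>R Y \<xi>"] by (simp add: dual_norm_scaleR power_mult_distrib)
    qed
    also have "\<dots> = c\<^sup>2 / 2 * V" by (simp add: V_def int)
    also have "\<dots> \<le> c\<^sup>2 / 2 * (2 * (dual_norm N \<mu>)\<^sup>2 + 5/2 * V / real b)"
    proof (rule mult_left_mono)
      show "V \<le> 2 * (dual_norm N \<mu>)\<^sup>2 + 5/2 * V / real b"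
        using V True zero_le_power2[of "dual_norm N \<mu>"] unfolding True of_nat_1 div_by_1 by linarith
    qed simp
    finally show ?thesis by (simp add: \<mu>_def V_def)
  next
    case False
    with b have b2: "real b \<ge> 2" by simp
    define Z where "Z \<xi> = (c / real b) *\<^sub>R (Y \<xi> - \<mu>)" for \<xi>
    have Z0: "measure_pmf.expectation p Z = 0"
      by (simp add: Z_def[abs_def] int \<mu>_def)
    have VZ: "measure_pmf.expectation p (\<lambda>\<xi>. (dual_norm N (Z \<xi>))\<^sup>2)
        \<le> (c / real b)\<^sup>2 * (5/2 * V + 5/3 * (dual_norm N \<mu>)\<^sup>2)"
    proof -
      have "measure_pmf.expectation p (\<lambda>\<xi>. (dual_norm N (Z \<xi>))\<^sup>2)
          \<le> measure_pmf.expectation p (\<lambda>\<xi>. (c / real b)\<^sup>2 * (5/2 * (dual_norm N (Y \<xi>))\<^sup>2 + 5/3 * (dual_norm N \<mu>)\<^sup>2))"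
      proof (intro expectation_mono_pmf fin)
        fix \<xi>
        have "(dual_norm N (Y \<xi> - \<mu>))\<^sup>2 \<le> (dual_norm N (Y \<xi>) + dual_norm N \<mu>)\<^sup>2"
          by (intro power_mono dual_norm_diff) auto
        also have "\<dots> \<le> 5/2 * (dual_norm N (Y \<xi>))\<^sup>2 + 5/3 * (dual_norm N \<mu>)\<^sup>2"
          using square_add_le[of "3/2" "dual_norm N (Y \<xi>)" "dual_norm N \<mu>"] by simp
        finally show "(dual_norm N (Z \<xi>))\<^sup>2 \<le> (c / real b)\<^sup>2 * (5/2 * (dual_norm N (Y \<xi>))\<^sup>2 + 5/3 * (dual_norm N \<mu>)\<^sup>2)"
          unfolding Z_def dual_norm_scaleR power_mult_distrib power2_abs by (intro mult_left_mono) auto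
      qed
      also have "\<dots> = (c / real b)\<^sup>2 * (5/2 * V + 5/3 * (dual_norm N \<mu>)\<^sup>2)"
        by (simp add: V_def int)
      finally show ?thesis .
    qed
    have "measure_pmf.expectation (replicate_pmf b p) (\<lambda>B. \<psi> (c *\<^sub>R (1 / real b) *\<^sub>R (\<Sum>\<xi>\<leftarrow>B. Y \<xi>)))
        = measure_pmf.expectation (replicate_pmf b p) (\<lambda>B. \<psi> (c *\<^sub>R \<mu> + (\<Sum>\<xi>\<leftarrow>B. Z \<xi>)))"
    proof (intro integral_cong_AE AE_pmfI)
      fix B assume "B \<in> set_pmf (replicate_pmf b p)"
      then have "length B = b" by (simp add: set_replicate_pmf)
      have "(\<Sum>\<xi>\<leftarrow>B. Z \<xi>) = (c / real b) *\<^sub>R ((\<Sum>\<xi>\<leftarrow>B. Y \<xi>) - real (length B) *\<^sub>R \<mu>)"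
        by (induction B) (auto simp: Z_def algebra_simps)
      then show "\<psi> (c *\<^sub>R (1 / real b) *\<^sub>R (\<Sum>\<xi>\<leftarrow>B. Y \<xi>)) = \<psi> (c *\<^sub>R \<mu> + (\<Sum>\<xi>\<leftarrow>B. Z \<xi>))"
        using b2 \<open>length B = b\<close> by (simp add: algebra_simps)
    qed auto
    also have "\<dots> \<le> \<psi> (c *\<^sub>R \<mu>) + real b / 2 * measure_pmf.expectation p (\<lambda>\<xi>. (dual_norm N (Z \<xi>))\<^sup>2)"
      by (rule expectation_smooth_centred_sum[OF fin smooth Z0])
    also have "\<dots> \<le> c\<^sup>2 / 2 * (dual_norm N \<mu>)\<^sup>2
        + real b / 2 * ((c / real b)\<^sup>2 * (5/2 * V + 5/3 * (dual_norm N \<mu>)\<^sup>2))"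
      using le[of "c *\<^sub>R \<mu>"]
      by (intro add_mono mult_left_mono VZ) (auto simp: dual_norm_scaleR power_mult_distrib)
    also have "\<dots> = c\<^sup>2 / 2 * ((1 + 5/3 * (1 / real b)) * (dual_norm N \<mu>)\<^sup>2 + 5/2 * V / real b)"
      using b2 by (simp add: field_simps power2_eq_square)
    also have "\<dots> \<le> c\<^sup>2 / 2 * (2 * (dual_norm N \<mu>)\<^sup>2 + 5/2 * V / real b)"
    proof (intro mult_left_mono add_mono mult_right_mono order.refl)
      show "1 + 5/3 * (1 / real b) \<le> 2" using b2 by (simp add: field_simps)
    qed auto
    finally show ?thesis by (simp add: \<mu>_def V_def)
  qed
qed

end

context bregman_kernel
begin

text \<open>The dual norm itself is compared with \<open>dual_bregman\<close> at an interior point. The comparison holds only for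
  small vectors, but the batch means take finitely many values, so all of them can be scaled by one
  small factor \<open>c\<close>, and both sides are homogeneous of degree two in \<open>c\<close>.\<close>
lemma dual_norm_batch_mean_second_moment:
  fixes Y :: "'b \<Rightarrow> 'a"
  assumes fin: "finite (set_pmf p)" and b: "b \<ge> 1"
    and lip: "\<And>x y. x \<in> dom_subdiff f \<Longrightarrow> y \<in> dom_subdiff f \<Longrightarrow>
      dual_norm N (grad f x - grad f y) \<le> Lf * N (x - y)"
  shows "measure_pmf.expectation (replicate_pmf b p) (\<lambda>B. (dual_norm N ((1 / real b) *\<^sub>R (\<Sum>\<xi>\<leftarrow>B. Y \<xi>)))\<^sup>2)
    \<le> Lf\<^sup>2 * (2 * (dual_norm N (measure_pmf.expectation p Y))\<^sup>2
        + 5/2 * measure_pmf.expectation p (\<lambda>\<xi>. (dual_norm N (Y \<xi>))\<^sup>2) / real b)"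
    (is "measure_pmf.expectation ?R (\<lambda>B. (dual_norm N (?Z B))\<^sup>2) \<le> Lf\<^sup>2 * ?W")
proof -
  obtain x where x: "x \<in> dom_subdiff f" "x \<in> interior (edom f)"
    using interior_dom_subdiff_point .
  obtain r where r: "r > 0"
    "\<And>w. dual_norm N w < r \<Longrightarrow> (dual_norm N w)\<^sup>2 \<le> 2 * Lf\<^sup>2 * dual_bregman x w"
    using dual_norm_le_dual_bregman_locally[OF lip x] by blast
  have finR: "finite (set_pmf ?R)" by (rule finite_set_replicate_pmf[OF fin])
  have int: "integrable ?R Z'" for Z' :: "'b list \<Rightarrow> real"
    by (intro integrable_measure_pmf_finite finR)
  define T where "T = 1 + (\<Sum>B\<in>set_pmf ?R. dual_norm N (?Z B))"
  have T: "T > 0" unfolding T_def by (intro add_pos_nonneg sum_nonneg) auto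
  define c where "c = r / T"
  have c: "c > 0" using r T by (simp add: c_def)
  have "c\<^sup>2 * measure_pmf.expectation ?R (\<lambda>B. (dual_norm N (?Z B))\<^sup>2)
      = measure_pmf.expectation ?R (\<lambda>B. (dual_norm N (c *\<^sub>R ?Z B))\<^sup>2)"
    by (simp only: dual_norm_scaleR[of c] power_mult_distrib power2_abs integral_mult_right_zero)
  also have "\<dots> \<le> measure_pmf.expectation ?R (\<lambda>B. 2 * Lf\<^sup>2 * dual_bregman x (c *\<^sub>R ?Z B))"
  proof (intro expectation_mono_pmf finR r(2))
    fix B assume "B \<in> set_pmf ?R"
    then have "dual_norm N (?Z B) < T"
      unfolding T_def using member_le_sum[of B "set_pmf ?R" "\<lambda>B. dual_norm N (?Z B)"] finR by fastforce
    then have "c * dual_norm N (?Z B) < c * T" using c by (rule mult_strict_left_mono)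
    also have "c * T = r" using T by (simp add: c_def)
    finally show "dual_norm N (c *\<^sub>R ?Z B) < r"
      by (simp only: dual_norm_scaleR[of c] abs_of_pos[OF c])
  qed
  also have "\<dots> = 2 * Lf\<^sup>2 * measure_pmf.expectation ?R (\<lambda>B. dual_bregman x (c *\<^sub>R ?Z B))"
    by simp
  also have "\<dots> \<le> 2 * Lf\<^sup>2 * (c\<^sup>2 / 2 * ?W)"
    using expectation_smooth_batch_mean[OF fin dual_bregman_smooth dual_bregman_le[OF x(1)] b, where Y = Y and c = c]
    by (intro mult_left_mono) auto
  also have "\<dots> = c\<^sup>2 * (Lf\<^sup>2 * ?W)" by (simp add: algebra_simps)
  finally show ?thesis using c by simp
qed

end

section \<open>The proximal step\<close>

context bregman_kernel
begin

lemma grad_inj_on: "inj_on (grad f) (dom_subdiff f)"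
proof (rule inj_onI)
  fix x y assume "x \<in> dom_subdiff f" "y \<in> dom_subdiff f" "grad f x = grad f y"
  then show "x = y" by (metis convex_conj_grad(1))
qed

text \<open>The optimality condition of the proximal step. Convexity of \<open>g\<close> turns minimality along a segment
  into a linear lower bound on the increments of \<open>f\<close>, and \<open>directional_derivative_ge\<close> replaces \<open>f\<close> by
  its linearisation. The point \<open>x0\<close> certifies that the minimal value is finite.\<close>
lemma prox_minimiser_subgradient:
  assumes g: "pcl_on K g" and \<alpha>: "0 < \<alpha>" and x0: "x0 \<in> edom g" and y: "y \<in> dom_subdiff f"
    and min: "is_arg_min (prox_objective f g \<alpha> \<Delta> y) (\<lambda>x. x \<in> K) z"
    and z: "z \<in> dom_subdiff f"
  shows "z \<in> edom g"
    and "- \<Delta> - (1 / \<alpha>) *\<^sub>R (grad f z - grad f y) \<in> subdifferential (\<lambda>x. g x + convex_indicator K x) z"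
proof -
  let ?gr = "\<lambda>x. real_of_ereal (g x)"
  let ?h = "\<lambda>x. \<alpha> * ?gr x + (\<alpha> *\<^sub>R \<Delta>) \<bullet> x + breg x y"
  have gf: "edom g \<subseteq> edom f" using generator by (simp add: bregman_generator_def)
  note greal = pcl_on_eq_real[OF g]
  have obj: "prox_objective f g \<alpha> \<Delta> y x = ereal (?h x)" if "x \<in> edom g" for x
    using greal[OF that] bregman_eq_breg[of x y] y that gf
    unfolding prox_objective_def by (metis plus_ereal.simps(1) subsetD times_ereal.simps(1))
  have minD: "prox_objective f g \<alpha> \<Delta> y z \<le> prox_objective f g \<alpha> \<Delta> y x" if "x \<in> edom g" for x
    using min that pcl_on_edom_subset[OF g] by (force simp: is_arg_min_def not_less)
  show zg: "z \<in> edom g"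
  proof (rule ccontr)
    assume "z \<notin> edom g"
    then have "g z = \<infinity>" by (simp add: edom_def)
    moreover have "bregman f z y = ereal (breg z y)"
      using bregman_eq_breg y z dom_subdiff_subset by blast
    ultimately have "prox_objective f g \<alpha> \<Delta> y z = \<infinity>"
      using \<alpha> by (simp add: prox_objective_def)
    with minD[OF x0] obj[OF x0] show False by simp
  qed
  have var: "- (\<alpha> * (?gr x - ?gr z)) - (\<alpha> *\<^sub>R \<Delta> - grad f y) \<bullet> (x - z) \<le> grad f z \<bullet> (x - z)"
    if x: "x \<in> edom g" for x
  proof (rule directional_derivative_ge[OF z])
    show "x \<in> edom f" using x gf by auto
    fix t :: real assume t: "0 < t" "t < 1"
    define w where "w = z + t *\<^sub>R (x - z)"
    have w: "w = (1 - t) *\<^sub>R z + t *\<^sub>R x" by (simp add: w_def algebra_simps)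
    have wg: "w \<in> edom g" and "?gr w \<le> (1 - t) * ?gr z + t * ?gr x"
      using pcl_on_convex_combination[OF g zg x t] w by simp_all
    then have "\<alpha> * ?gr w \<le> \<alpha> * ((1 - t) * ?gr z + t * ?gr x)"
      using \<alpha> by simp
    moreover have "?h z \<le> ?h w"
      using minD[OF wg] obj[OF zg] obj[OF wg] by simp
    ultimately have "\<alpha> * ?gr z + (\<alpha> *\<^sub>R \<Delta>) \<bullet> z + breg z y
        \<le> \<alpha> * ((1 - t) * ?gr z + t * ?gr x) + (\<alpha> *\<^sub>R \<Delta>) \<bullet> w + breg w y" by linarith
    then have "t * (- (\<alpha> * (?gr x - ?gr z)) - (\<alpha> *\<^sub>R \<Delta> - grad f y) \<bullet> (x - z)) \<le> fr w - fr z"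
      unfolding breg_def w_def by (simp add: algebra_simps)
    then show "t * (- (\<alpha> * (?gr x - ?gr z)) - (\<alpha> *\<^sub>R \<Delta> - grad f y) \<bullet> (x - z))
        \<le> fr (z + t *\<^sub>R (x - z)) - fr z" by (simp add: w_def)
  qed
  let ?v = "- \<Delta> - (1 / \<alpha>) *\<^sub>R (grad f z - grad f y)"
  have sub: "?gr z + ?v \<bullet> (x - z) \<le> ?gr x" if "x \<in> edom g" for x
  proof -
    have "\<alpha> *\<^sub>R ?v = - (\<alpha> *\<^sub>R \<Delta> - grad f y) - grad f z"
      using \<alpha> by (simp add: scaleR_diff_right)
    then have "\<alpha> * (?v \<bullet> (x - z)) = - ((\<alpha> *\<^sub>R \<Delta> - grad f y) \<bullet> (x - z)) - grad f z \<bullet> (x - z)"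
      by (metis inner_diff_left inner_minus_left inner_scaleR_left)
    then have "\<alpha> * (?gr z + ?v \<bullet> (x - z)) \<le> \<alpha> * ?gr x"
      using var[OF that] by (simp add: distrib_left right_diff_distrib)
    then show ?thesis using \<alpha> by (simp only: mult_le_cancel_left_pos)
  qed
  have zK: "z \<in> K" using zg pcl_on_edom_subset[OF g] by auto
  have "g z + ereal (?v \<bullet> (x - z)) \<le> g x + convex_indicator K x" for x
  proof (cases "x \<in> edom g")
    case True
    then have "x \<in> K" using pcl_on_edom_subset[OF g] by auto
    then have "g x + convex_indicator K x = g x" by (simp add: convex_indicator_def)
    then show ?thesis using sub[OF True] greal[OF True] greal[OF zg]
      by (metis ereal_less_eq(3) plus_ereal.simps(1))
  next
    case False
    then show ?thesis by (simp add: edom_def)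
  qed
  moreover have "\<bar>g z\<bar> \<noteq> \<infinity>" using greal[OF zg] by (cases "g z") auto
  ultimately show "?v \<in> subdifferential (\<lambda>x. g x + convex_indicator K x) z"
    using zK by (simp add: subdifferential_def convex_indicator_def)
qed

text \<open>The three-point identity of Bregman distances, averaged with weights \<open>\<gamma>\<close> and \<open>1 - \<gamma>\<close>.\<close>
lemma reflected_four_point_identity:
  assumes "\<alpha> \<noteq> 0"
    and "u = v - (1 / \<alpha>) *\<^sub>R (grad f z - (\<gamma> *\<^sub>R grad f x + (1 - \<gamma>) *\<^sub>R grad f x'))"
  shows "breg y z = \<gamma> * breg y x + (1 - \<gamma>) * breg y x' - \<gamma> * breg z x - (1 - \<gamma>) * breg z x'
    + \<alpha> * ((v - u) \<bullet> (z - y))"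
proof -
  have "\<alpha> *\<^sub>R (v - u) = grad f z - (\<gamma> *\<^sub>R grad f x + (1 - \<gamma>) *\<^sub>R grad f x')"
    using assms by simp
  then have "\<alpha> * ((v - u) \<bullet> (z - y)) = (grad f z - (\<gamma> *\<^sub>R grad f x + (1 - \<gamma>) *\<^sub>R grad f x')) \<bullet> (z - y)"
    by (metis inner_scaleR_left)
  show ?thesis
    unfolding breg_def \<open>\<alpha> * ((v - u) \<bullet> (z - y)) = _\<close> by (simp add: algebra_simps)
qed

end

section \<open>One step of the reflected method\<close>

text \<open>The parameter \<open>\<omega>\<close> is the weight with which squared residuals enter the Lyapunov function, \<open>\<kappa>\<close> is
  the total price of a squared residual: \<open>\<omega>\<close> plus what the weak Minty inequality costs. The second
  moment of the sampling noise is at most \<open>m\<close> times the last squared displacement, and \<open>\<beta>\<close> is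
  the weight of that displacement. The two budget inequalities say that the Bregman terms gained in a step pay for its
  displacement and for the displacement from the previous iterate.\<close>
locale reflected_method = bregman_kernel N K f g
  for N :: "'a::euclidean_space \<Rightarrow> real" and K and f g :: "'a \<Rightarrow> ereal" +
  fixes F :: "'a \<Rightarrow> 'a" and xstar :: 'a and b :: nat
    and \<alpha> \<gamma> \<rho> L Lbar Lf \<omega> \<kappa> m \<beta> :: real
  assumes \<alpha>: "0 < \<alpha>" and \<gamma>: "1/2 < \<gamma>" "\<gamma> \<le> 1" and \<rho>: "0 < \<rho>" and b: "1 \<le> b" and \<omega>: "0 \<le> \<omega>"
    and F_lipschitz: "\<And>x y. x \<in> edom g \<Longrightarrow> y \<in> edom g \<Longrightarrow> dual_norm N (F x - F y) \<le> L * N (x - y)"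
    and grad_lipschitz: "\<And>x y. x \<in> dom_subdiff f \<Longrightarrow> y \<in> dom_subdiff f \<Longrightarrow>
      dual_norm N (grad f x - grad f y) \<le> Lf * N (x - y)"
    and xstar: "xstar \<in> edom f"
    and \<kappa>_eq: "\<kappa> = \<omega> + \<alpha> * \<rho>"
    and m_eq: "m = 2 * L\<^sup>2 + 5/2 * (Lbar\<^sup>2 / real b)"
    and \<beta>_eq: "\<beta> = (\<alpha>\<^sup>2 + 4 * \<kappa> * Lf\<^sup>2) * m"
    and budget_step: "\<beta> + \<kappa> * (2 * \<gamma> * (Lf\<^sup>2 / \<alpha>\<^sup>2) + 4 * L\<^sup>2) \<le> (\<gamma> - 1/2) / 2"
    and budget_momentum: "2 * \<kappa> * (Lf\<^sup>2 / \<alpha>\<^sup>2) \<le> 1/2"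
begin

text \<open>The first two terms measure the distance to \<open>xstar\<close>. The inner product is the operator difference
  that the extrapolated estimate still owes: it telescopes against the next step. The last term
  pays for the sampling noise of the next step.\<close>
definition energy :: "'a \<Rightarrow> 'a \<Rightarrow> real" where
  "energy x x' = breg xstar x + (1 - \<gamma>) * breg xstar x'
     - \<alpha> * ((F x - F x') \<bullet> (x - xstar)) + \<beta> * (N (x - x'))\<^sup>2"

lemma \<kappa>_nonneg: "0 \<le> \<kappa>"
  using \<kappa>_eq \<omega> \<alpha> \<rho> by simp

lemma m_nonneg: "0 \<le> m"
  using m_eq by simp

lemma F_lipschitz_square:
  assumes "x \<in> edom g" "y \<in> edom g"
  shows "(dual_norm N (F x - F y))\<^sup>2 \<le> L\<^sup>2 * (N (x - y))\<^sup>2"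
  using power_mono[OF F_lipschitz[OF assms], of 2] by (simp add: power_mult_distrib)

text \<open>The inner product is the only term that can be negative; Young's inequality splits it between
  \<open>breg xstar x\<close> and the displacement term, where \<open>\<beta> \<ge> \<alpha>\<^sup>2 * m \<ge> 2 * \<alpha>\<^sup>2 * L\<^sup>2\<close> leaves room.\<close>
lemma energy_nonneg:
  assumes "x \<in> edom g" "x' \<in> edom g" "x \<in> dom_subdiff f" "x' \<in> dom_subdiff f"
  shows "0 \<le> energy x x'"
proof -
  have "\<alpha> * ((F x - F x') \<bullet> (x - xstar)) \<le> \<alpha>\<^sup>2 / 2 * (dual_norm N (F x - F x'))\<^sup>2 + 1/2 * (N (xstar - x))\<^sup>2"
    using inner_le_Young[of "\<alpha> *\<^sub>R (F x - F x')" "x - xstar"] N_minus_commute[of xstar x]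
    by (simp add: dual_norm_scaleR power_mult_distrib)
  also have "\<dots> \<le> \<alpha>\<^sup>2 / 2 * (L\<^sup>2 * (N (x - x'))\<^sup>2) + breg xstar x"
    using F_lipschitz_square[OF assms(1,2)] breg_ge[OF xstar assms(3)]
    by (intro add_mono mult_left_mono) auto
  also have "\<alpha>\<^sup>2 / 2 * (L\<^sup>2 * (N (x - x'))\<^sup>2) \<le> \<beta> * (N (x - x'))\<^sup>2"
  proof -
    have "\<alpha>\<^sup>2 / 2 * L\<^sup>2 \<le> \<alpha>\<^sup>2 * m"
      unfolding m_eq by (simp add: algebra_simps)
    also have "\<dots> \<le> \<beta>"
      unfolding \<beta>_eq using \<kappa>_nonneg m_nonneg by (intro mult_right_mono) auto
    finally have "\<alpha>\<^sup>2 / 2 * L\<^sup>2 * (N (x - x'))\<^sup>2 \<le> \<beta> * (N (x - x'))\<^sup>2"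
      by (intro mult_right_mono) auto
    then show ?thesis by (simp only: mult.assoc)
  qed
  finally have "\<alpha> * ((F x - F x') \<bullet> (x - xstar)) \<le> \<beta> * (N (x - x'))\<^sup>2 + breg xstar x" by simp
  moreover have "0 \<le> (1 - \<gamma>) * breg xstar x'"
    using \<gamma>(2) order_trans[OF _ breg_ge[OF xstar assms(4)]] by simp
  ultimately show ?thesis by (simp add: energy_def)
qed

lemma energy_self [simp]: "energy x x = (2 - \<gamma>) * breg xstar x"
  by (simp add: energy_def algebra_simps)

text \<open>The residual has an operator part, a noise part and a gradient part. The weights of the square are
  chosen unevenly: the gradient part gets 2 and the other two get 4, since half of the room that
  the budget gives to the gradient part must absorb the factor \<open>Lf\<^sup>2\<close> lost in bounding the
  second moment of the noise in the dual norm.\<close>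
lemma residual_bound:
  assumes mem: "x \<in> edom g" "z \<in> edom g" "x \<in> dom_subdiff f" "x' \<in> dom_subdiff f" "z \<in> dom_subdiff f"
    and u: "u = F z - (F x + \<zeta>) - (1 / \<alpha>) *\<^sub>R (grad f z - (\<gamma> *\<^sub>R grad f x + (1 - \<gamma>) *\<^sub>R grad f x'))"
  shows "(dual_norm N u)\<^sup>2 \<le> (2 * \<gamma> * (Lf\<^sup>2 / \<alpha>\<^sup>2) + 4 * L\<^sup>2) * (N (z - x))\<^sup>2
    + 2 * (Lf\<^sup>2 / \<alpha>\<^sup>2) * (1 - \<gamma>) * (N (z - x'))\<^sup>2 + 4 * (dual_norm N \<zeta>)\<^sup>2"
proof -
  define w where "w = (1 / \<alpha>) *\<^sub>R (\<gamma> *\<^sub>R (grad f z - grad f x) + (1 - \<gamma>) *\<^sub>R (grad f z - grad f x'))"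
  define n n' where "n = N (z - x)" and "n' = N (z - x')"
  have u_eq: "u = ((F z - F x) - \<zeta>) - w"
    by (simp add: u w_def algebra_simps)
  have "dual_norm N u \<le> (dual_norm N (F z - F x) + dual_norm N \<zeta>) + dual_norm N w"
    unfolding u_eq using dual_norm_diff[of "(F z - F x) - \<zeta>" w] dual_norm_diff[of "F z - F x" \<zeta>] by linarith
  then have "(dual_norm N u)\<^sup>2 \<le> ((dual_norm N (F z - F x) + dual_norm N \<zeta>) + dual_norm N w)\<^sup>2"
    by (intro power_mono) auto
  also have "\<dots> \<le> 2 * (dual_norm N (F z - F x) + dual_norm N \<zeta>)\<^sup>2 + 2 * (dual_norm N w)\<^sup>2"
    using square_add_le[of 1] by simp
  also have "(dual_norm N (F z - F x) + dual_norm N \<zeta>)\<^sup>2 \<le> 2 * (L\<^sup>2 * n\<^sup>2) + 2 * (dual_norm N \<zeta>)\<^sup>2"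
    using square_add_le[of 1 "dual_norm N (F z - F x)" "dual_norm N \<zeta>"] F_lipschitz_square[OF mem(2,1)]
    by (simp add: n_def)
  also have "(dual_norm N w)\<^sup>2 \<le> Lf\<^sup>2 / \<alpha>\<^sup>2 * (\<gamma> * n\<^sup>2 + (1 - \<gamma>) * n'\<^sup>2)"
  proof -
    have "dual_norm N w \<le> 1 / \<alpha> * (\<gamma> * dual_norm N (grad f z - grad f x) + (1 - \<gamma>) * dual_norm N (grad f z - grad f x'))"
      unfolding w_def using \<alpha> \<gamma> dual_norm_triangle[of "\<gamma> *\<^sub>R (grad f z - grad f x)" "(1 - \<gamma>) *\<^sub>R (grad f z - grad f x')"]
      by (simp add: dual_norm_scaleR divide_right_mono)
    also have "\<dots> \<le> 1 / \<alpha> * (\<gamma> * (Lf * n) + (1 - \<gamma>) * (Lf * n'))"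
      unfolding n_def n'_def using \<alpha> \<gamma> mem by (intro mult_left_mono add_mono grad_lipschitz) auto
    also have "\<dots> = Lf / \<alpha> * (\<gamma> * n + (1 - \<gamma>) * n')"
      by (simp add: algebra_simps)
    finally have "(dual_norm N w)\<^sup>2 \<le> (Lf / \<alpha> * (\<gamma> * n + (1 - \<gamma>) * n'))\<^sup>2"
      by (intro power_mono) auto
    also have "\<dots> = Lf\<^sup>2 / \<alpha>\<^sup>2 * (\<gamma> * n + (1 - \<gamma>) * n')\<^sup>2"
      by (simp add: power_mult_distrib power_divide)
    also have "\<dots> \<le> Lf\<^sup>2 / \<alpha>\<^sup>2 * (\<gamma> * n\<^sup>2 + (1 - \<gamma>) * n'\<^sup>2)"
    proof (rule mult_left_mono)
      have "\<gamma> * n\<^sup>2 + (1 - \<gamma>) * n'\<^sup>2 - (\<gamma> * n + (1 - \<gamma>) * n')\<^sup>2 = \<gamma> * (1 - \<gamma>) * (n - n')\<^sup>2"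
        by (simp add: power2_eq_square algebra_simps)
      also have "\<dots> \<ge> 0" using \<gamma> by simp
      finally show "(\<gamma> * n + (1 - \<gamma>) * n')\<^sup>2 \<le> \<gamma> * n\<^sup>2 + (1 - \<gamma>) * n'\<^sup>2" by simp
    qed simp
    finally show ?thesis .
  qed
  finally show ?thesis by (simp add: n_def n'_def algebra_simps diff_divide_distrib)
qed

text \<open>Pathwise descent. The weak Minty inequality disposes of the residual in the four-point
  identity. The noise is split into its action on \<open>x - xstar\<close>, which has mean zero after
  compensation by \<open>F x - F x'\<close>, and its action on the step \<open>z - x\<close>, for which
  the Fenchel--Young inequality gives up half of \<open>breg z x\<close>; this half is the 1/2 in \<open>\<gamma> - 1/2\<close>.\<close>
lemma energy_step:
  assumes mem: "x \<in> edom g" "z \<in> edom g" "x \<in> dom_subdiff f" "x' \<in> dom_subdiff f" "z \<in> dom_subdiff f"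
    and u: "u = F z - (F x + \<zeta>) - (1 / \<alpha>) *\<^sub>R (grad f z - (\<gamma> *\<^sub>R grad f x + (1 - \<gamma>) *\<^sub>R grad f x'))"
    and weak_minty: "- \<rho> * (dual_norm N u)\<^sup>2 \<le> u \<bullet> (z - xstar)"
  shows "energy z x + \<omega> * (dual_norm N u)\<^sup>2 \<le> energy x x' - \<beta> * (N (x - x'))\<^sup>2
    + \<alpha> * ((F x - F x' - \<zeta>) \<bullet> (x - xstar))
    + 1/2 * dual_bregman x (- (2 * \<alpha>) *\<^sub>R \<zeta>) + 4 * \<kappa> * (dual_norm N \<zeta>)\<^sup>2"
proof -
  define A where "A = (N (z - x))\<^sup>2"
  define E where "E = (N (z - x'))\<^sup>2"
  define U where "U = (dual_norm N u)\<^sup>2"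
  define Z where "Z = (dual_norm N \<zeta>)\<^sup>2"
  have zf: "z \<in> edom f" using mem dom_subdiff_subset by auto
  have id: "breg xstar z = \<gamma> * breg xstar x + (1 - \<gamma>) * breg xstar x' - \<gamma> * breg z x - (1 - \<gamma>) * breg z x'
    + \<alpha> * ((F z - (F x + \<zeta>) - u) \<bullet> (z - xstar))"
    using \<alpha> by (intro reflected_four_point_identity) (auto simp: u)
  have minty: "- (\<alpha> * (u \<bullet> (z - xstar))) \<le> \<alpha> * \<rho> * U"
    using mult_left_mono[OF weak_minty, of \<alpha>] \<alpha> by (simp add: U_def)
  have fenchel: "- (\<alpha> * (\<zeta> \<bullet> (z - x))) \<le> 1/2 * breg z x + 1/2 * dual_bregman x (- (2 * \<alpha>) *\<^sub>R \<zeta>)"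
    using Fenchel_Young_breg[OF mem(3) zf, of "- (2 * \<alpha>) *\<^sub>R \<zeta>"] by simp
  \<comment> \<open>what remains of the two Bregman terms pays for the displacement and for the residual\<close>
  define c where "c = 2 * \<gamma> * (Lf\<^sup>2 / \<alpha>\<^sup>2) + 4 * L\<^sup>2"
  define q where "q = 2 * (Lf\<^sup>2 / \<alpha>\<^sup>2)"
  have "(\<gamma> - 1/2) * (1/2 * A) \<le> (\<gamma> - 1/2) * breg z x"
    unfolding A_def using \<gamma> breg_ge[OF zf mem(3)] by (intro mult_left_mono) auto
  moreover have "(1 - \<gamma>) * (1/2 * E) \<le> (1 - \<gamma>) * breg z x'"
    unfolding E_def using \<gamma> breg_ge[OF zf mem(4)] by (intro mult_left_mono) auto
  moreover have "\<kappa> * U \<le> \<kappa> * (c * A + q * (1 - \<gamma>) * E + 4 * Z)"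
    unfolding U_def A_def E_def Z_def c_def q_def
    using residual_bound[OF mem u] \<kappa>_nonneg by (rule mult_left_mono)
  moreover have "(\<beta> + \<kappa> * c) * A \<le> (\<gamma> - 1/2) / 2 * A"
    using budget_step by (intro mult_right_mono) (auto simp: A_def c_def)
  moreover have "(\<kappa> * q) * ((1 - \<gamma>) * E) \<le> 1/2 * ((1 - \<gamma>) * E)"
    using budget_momentum \<gamma> by (intro mult_right_mono) (auto simp: E_def q_def mult.commute)
  ultimately have main: "\<beta> * A + \<kappa> * U \<le> (\<gamma> - 1/2) * breg z x + (1 - \<gamma>) * breg z x' + 4 * \<kappa> * Z"
    by (simp add: algebra_simps add_divide_distrib diff_divide_distrib)
  have split: "\<alpha> * ((F z - (F x + \<zeta>) - u) \<bullet> (z - xstar)) =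
      \<alpha> * ((F z - F x) \<bullet> (z - xstar)) - \<alpha> * ((F x - F x') \<bullet> (x - xstar))
      + \<alpha> * ((F x - F x' - \<zeta>) \<bullet> (x - xstar)) - \<alpha> * (\<zeta> \<bullet> (z - x)) - \<alpha> * (u \<bullet> (z - xstar))"
    by (simp add: algebra_simps)
  have "energy z x + \<omega> * U = breg xstar x + (1 - \<gamma>) * breg xstar x' - \<gamma> * breg z x - (1 - \<gamma>) * breg z x'
      - \<alpha> * ((F x - F x') \<bullet> (x - xstar)) + \<alpha> * ((F x - F x' - \<zeta>) \<bullet> (x - xstar))
      - \<alpha> * (\<zeta> \<bullet> (z - x)) - \<alpha> * (u \<bullet> (z - xstar)) + \<beta> * A + \<omega> * U"
    unfolding energy_def A_def[symmetric] id split by (simp add: algebra_simps)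
  also have "\<dots> \<le> breg xstar x + (1 - \<gamma>) * breg xstar x'
      - \<alpha> * ((F x - F x') \<bullet> (x - xstar)) + \<alpha> * ((F x - F x' - \<zeta>) \<bullet> (x - xstar))
      + 1/2 * dual_bregman x (- (2 * \<alpha>) *\<^sub>R \<zeta>) + 4 * \<kappa> * Z"
    using minty fenchel main unfolding \<kappa>_eq by (simp add: algebra_simps)
  finally show ?thesis
    by (simp add: U_def Z_def energy_def)
qed

text \<open>Taking expectations, the inner product vanishes and both noise terms are bounded by multiples of
  \<open>m * (N (x - x'))\<^sup>2\<close>; their sum is exactly the term \<open>\<beta> * (N (x - x'))\<^sup>2\<close> set aside in the energy.\<close>
lemma expected_energy_step:
  fixes Y :: "nat \<Rightarrow> 'a" and z u :: "nat list \<Rightarrow> 'a"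
  assumes fin: "finite (set_pmf p)"
    and mem: "x \<in> edom g" "x' \<in> edom g" "x \<in> dom_subdiff f" "x' \<in> dom_subdiff f"
    and mean: "measure_pmf.expectation p Y = F x - F x'"
    and var: "measure_pmf.expectation p (\<lambda>\<xi>. (dual_norm N (Y \<xi>))\<^sup>2) \<le> Lbar\<^sup>2 * (N (x - x'))\<^sup>2"
    and z: "\<And>B. B \<in> set_pmf (replicate_pmf b p) \<Longrightarrow> z B \<in> edom g \<and> z B \<in> dom_subdiff f"
    and u: "\<And>B. B \<in> set_pmf (replicate_pmf b p) \<Longrightarrow>
      u B = F (z B) - (F x + (1 / real b) *\<^sub>R (\<Sum>\<xi>\<leftarrow>B. Y \<xi>))
        - (1 / \<alpha>) *\<^sub>R (grad f (z B) - (\<gamma> *\<^sub>R grad f x + (1 - \<gamma>) *\<^sub>R grad f x'))"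
    and weak_minty: "\<And>B. B \<in> set_pmf (replicate_pmf b p) \<Longrightarrow>
      - \<rho> * (dual_norm N (u B))\<^sup>2 \<le> u B \<bullet> (z B - xstar)"
  shows "measure_pmf.expectation (replicate_pmf b p) (\<lambda>B. energy (z B) x + \<omega> * (dual_norm N (u B))\<^sup>2)
    \<le> energy x x'"
proof -
  let ?R = "replicate_pmf b p"
  define \<zeta> where "\<zeta> B = (1 / real b) *\<^sub>R (\<Sum>\<xi>\<leftarrow>B. Y \<xi>)" for B
  define a where "a = (N (x - x'))\<^sup>2"
  define W where "W = 2 * (dual_norm N (measure_pmf.expectation p Y))\<^sup>2
        + 5/2 * measure_pmf.expectation p (\<lambda>\<xi>. (dual_norm N (Y \<xi>))\<^sup>2) / real b"
  have finR: "finite (set_pmf ?R)" by (rule finite_set_replicate_pmf[OF fin])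
  have int: "integrable ?R h" for h :: "nat list \<Rightarrow> real"
    by (intro integrable_measure_pmf_finite finR)
  have W: "W \<le> m * a"
  proof -
    have "5/2 * measure_pmf.expectation p (\<lambda>\<xi>. (dual_norm N (Y \<xi>))\<^sup>2) / real b \<le> 5/2 * (Lbar\<^sup>2 * a) / real b"
      using var by (intro divide_right_mono mult_left_mono) (auto simp: a_def)
    moreover have "(dual_norm N (measure_pmf.expectation p Y))\<^sup>2 \<le> L\<^sup>2 * a"
      unfolding mean a_def by (rule F_lipschitz_square[OF mem(1,2)])
    ultimately have "W \<le> 2 * (L\<^sup>2 * a) + 5/2 * (Lbar\<^sup>2 * a) / real b"
      unfolding W_def by linarith
    also have "\<dots> = m * a" by (simp add: m_eq algebra_simps)
    finally show ?thesis .
  qed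
  have unbiased: "measure_pmf.expectation ?R (\<lambda>B. (F x - F x' - \<zeta> B) \<bullet> (x - xstar)) = 0"
  proof -
    have "measure_pmf.expectation ?R (\<lambda>B. (x - xstar) \<bullet> \<zeta> B)
        = (1 / real b) * measure_pmf.expectation ?R (\<lambda>B. (x - xstar) \<bullet> (\<Sum>\<xi>\<leftarrow>B. Y \<xi>))"
      by (simp add: \<zeta>_def)
    also have "\<dots> = (x - xstar) \<bullet> (F x - F x')"
      unfolding expectation_sum_list_replicate_pmf[OF fin] mean using b by simp
    finally show ?thesis
      by (simp add: inner_commute[of _ "x - xstar"] inner_diff_right[of "x - xstar"] int)
  qed
  have dual: "measure_pmf.expectation ?R (\<lambda>B. dual_bregman x (- (2 * \<alpha>) *\<^sub>R \<zeta> B)) \<le> (2 * \<alpha>)\<^sup>2 / 2 * W"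
    using expectation_smooth_batch_mean[OF fin dual_bregman_smooth dual_bregman_le[OF mem(3)] b, where Y = Y and c = "- (2 * \<alpha>)"]
    by (simp add: \<zeta>_def W_def)
  have second: "measure_pmf.expectation ?R (\<lambda>B. (dual_norm N (\<zeta> B))\<^sup>2) \<le> Lf\<^sup>2 * W"
    unfolding \<zeta>_def W_def by (rule dual_norm_batch_mean_second_moment[OF fin b grad_lipschitz])
  have "measure_pmf.expectation ?R (\<lambda>B. energy (z B) x + \<omega> * (dual_norm N (u B))\<^sup>2)
      \<le> measure_pmf.expectation ?R (\<lambda>B. energy x x' - \<beta> * a
        + \<alpha> * ((F x - F x' - \<zeta> B) \<bullet> (x - xstar))
        + 1/2 * dual_bregman x (- (2 * \<alpha>) *\<^sub>R \<zeta> B) + 4 * \<kappa> * (dual_norm N (\<zeta> B))\<^sup>2)"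
    unfolding a_def
    by (intro expectation_mono_pmf finR energy_step) (use mem z u weak_minty \<zeta>_def in auto)
  also have "\<dots> = energy x x' - \<beta> * a
      + 1/2 * measure_pmf.expectation ?R (\<lambda>B. dual_bregman x (- (2 * \<alpha>) *\<^sub>R \<zeta> B))
      + 4 * \<kappa> * measure_pmf.expectation ?R (\<lambda>B. (dual_norm N (\<zeta> B))\<^sup>2)"
    by (simp add: int unbiased)
  also have "\<dots> \<le> energy x x' - \<beta> * a + 1/2 * ((2 * \<alpha>)\<^sup>2 / 2 * W) + 4 * \<kappa> * (Lf\<^sup>2 * W)"
    using dual second \<kappa>_nonneg by (intro add_mono mult_left_mono) auto
  also have "\<dots> = energy x x' - \<beta> * a + (\<alpha>\<^sup>2 + 4 * \<kappa> * Lf\<^sup>2) * W"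
    by (simp add: power2_eq_square algebra_simps)
  also have "\<dots> \<le> energy x x' - \<beta> * a + (\<alpha>\<^sup>2 + 4 * \<kappa> * Lf\<^sup>2) * (m * a)"
    using W \<kappa>_nonneg by (intro add_left_mono mult_left_mono) auto
  also have "\<dots> = energy x x'"
    by (simp add: \<beta>_eq algebra_simps)
  finally show ?thesis .
qed

end

section \<open>Trajectories of the algorithm\<close>

definition advance ::
  "'a::euclidean_space set \<Rightarrow> ('a \<Rightarrow> ereal) \<Rightarrow> ('a \<Rightarrow> ereal) \<Rightarrow> ('a \<Rightarrow> 'a) \<Rightarrow>
   (nat \<Rightarrow> 'a \<Rightarrow> 'a) \<Rightarrow> real \<Rightarrow> real \<Rightarrow> nat \<Rightarrow> int \<Rightarrow> 'a trajectory \<Rightarrow> nat list \<Rightarrow> 'a trajectory"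
  where
  "advance K f g F F\<xi> \<gamma> \<alpha> b s h B =
     (let \<Delta> = batch_estimate F F\<xi> b h s B;
          x' = arg_min_on (prox_objective f g \<alpha> \<Delta> (mirror_pt f \<gamma> h s)) K
      in Trajectory ((iter h)(s + 1 := x')) ((wpt h)(s + 1 := x')) ((dlt h)(s := \<Delta>)))"

lemma bernoulli_pmf_1_eq: "bernoulli_pmf 1 = return_pmf True"
proof (rule pmf_eqI)
  fix c show "pmf (bernoulli_pmf 1) c = pmf (return_pmf True) c" by (cases c) auto
qed

lemma algorithm_step_p1:
  "algorithm_step K f g F F\<xi> Q \<gamma> 1 \<alpha> b s h =
     map_pmf (advance K f g F F\<xi> \<gamma> \<alpha> b s h) (replicate_pmf b (Q (iter h s) (wpt h (s - 1))))"
  by (simp add: algorithm_step_def bernoulli_pmf_1_eq bind_return_pmf map_pmf_def Let_def advance_def)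

text \<open>Well-definedness is stated for complete runs. A partial run of positive probability is the initial
  part of a complete one, and so inherits it.\<close>
lemma algorithm_run_extends:
  assumes "s \<le> S" "h \<in> set_pmf (algorithm_run K f g F F\<xi> Q \<gamma> 1 \<alpha> b x0 s)"
  shows "\<exists>h' \<in> set_pmf (algorithm_run K f g F F\<xi> Q \<gamma> 1 \<alpha> b x0 S).
    (\<forall>k \<le> int s. iter h' k = iter h k) \<and> (\<forall>k < int s. dlt h' k = dlt h k)"
  using assms(1)
proof (induction S rule: dec_induct)
  case base
  then show ?case using assms(2) by auto
next
  case (step S)
  then obtain h' where h': "h' \<in> set_pmf (algorithm_run K f g F F\<xi> Q \<gamma> 1 \<alpha> b x0 S)"
    "\<forall>k \<le> int s. iter h' k = iter h k" "\<forall>k < int s. dlt h' k = dlt h k"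
    by blast
  obtain B where B: "B \<in> set_pmf (replicate_pmf b (Q (iter h' (int S)) (wpt h' (int S - 1))))"
    by (meson ex_in_conv set_pmf_not_empty)
  let ?h = "advance K f g F F\<xi> \<gamma> \<alpha> b (int S) h' B"
  have "?h \<in> set_pmf (algorithm_run K f g F F\<xi> Q \<gamma> 1 \<alpha> b x0 (Suc S))"
    using h'(1) B by (auto simp: algorithm_step_p1 intro!: bexI[of _ h'])
  moreover have "(\<forall>k \<le> int s. iter ?h k = iter h k) \<and> (\<forall>k < int s. dlt ?h k = dlt h k)"
    using h'(2,3) step.hyps by (auto simp: advance_def Let_def)
  ultimately show ?case by blast
qed

locale reflected_run = reflected_method N K f g F xstar b \<alpha> \<gamma> \<rho> L Lbar Lf \<omega> \<kappa> m \<beta>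
  for N :: "'a::euclidean_space \<Rightarrow> real" and K and f g :: "'a \<Rightarrow> ereal"
    and F :: "'a \<Rightarrow> 'a" and xstar :: 'a and b :: nat
    and \<alpha> \<gamma> \<rho> L Lbar Lf \<omega> \<kappa> m \<beta> :: real +
  fixes M S :: nat and F\<xi> :: "nat \<Rightarrow> 'a \<Rightarrow> 'a" and Q :: "'a \<Rightarrow> 'a \<Rightarrow> nat pmf" and x0 :: 'a
  assumes g: "pcl_on K g"
    and variable_lip: "variable_lipschitz_oracle N g F M F\<xi> Q Lbar"
    and weak_minty: "\<And>x v. x \<in> K \<Longrightarrow> v \<in> subdifferential (\<lambda>z. g z + convex_indicator K z) x \<Longrightarrow>
      - \<rho> * (dual_norm N (F x + v))\<^sup>2 \<le> (F x + v) \<bullet> (x - xstar)"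
    and well_defined:
      "iterates_well_defined K f g \<gamma> \<alpha> x0 S (algorithm_run K f g F F\<xi> Q \<gamma> 1 \<alpha> b x0 S)"
begin

abbreviation run :: "nat \<Rightarrow> 'a trajectory pmf" where
  "run \<equiv> algorithm_run K f g F F\<xi> Q \<gamma> 1 \<alpha> b x0"

definition regular_at :: "nat \<Rightarrow> 'a trajectory \<Rightarrow> bool" where
  "regular_at s h \<longleftrightarrow> (\<forall>k \<le> int s. wpt h k = iter h k) \<and>
     (\<forall>k \<in> {int s - 1, int s}. iter h k \<in> edom g \<and> iter h k \<in> dom_subdiff f)"

definition lyapunov :: "nat \<Rightarrow> 'a trajectory \<Rightarrow> real" where
  "lyapunov s h = energy (iter h (int s)) (iter h (int s - 1))
     + \<omega> * (\<Sum>k<s. (dual_norm N (residual f F \<gamma> \<alpha> h (int k)))\<^sup>2)"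

text \<open>The argument of the weak Minty inequality at the new iterate is the residual: the optimality condition of
  the proximal step identifies residual minus operator value as a subgradient of \<open>g\<close>.\<close>
lemma advance_regular:
  assumes s: "s < S" and h: "h \<in> set_pmf (run s)" "regular_at s h"
    and B: "B \<in> set_pmf (replicate_pmf b (Q (iter h (int s)) (iter h (int s - 1))))"
  defines "h' \<equiv> advance K f g F F\<xi> \<gamma> \<alpha> b (int s) h B"
  shows "h' \<in> set_pmf (run (Suc s))" and "regular_at (Suc s) h'"
    and "- \<rho> * (dual_norm N (residual f F \<gamma> \<alpha> h' (int s)))\<^sup>2
      \<le> residual f F \<gamma> \<alpha> h' (int s) \<bullet> (iter h' (int s + 1) - xstar)"
proof -
  let ?s = "int s"
  define \<Delta> where "\<Delta> = batch_estimate F F\<xi> b h ?s B"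
  define X where "X = arg_min_on (prox_objective f g \<alpha> \<Delta> (mirror_pt f \<gamma> h ?s)) K"
  have h'_eq: "h' = Trajectory ((iter h)(?s + 1 := X)) ((wpt h)(?s + 1 := X)) ((dlt h)(?s := \<Delta>))"
    by (simp add: h'_def advance_def X_def \<Delta>_def Let_def)
  have wpt: "wpt h (?s - 1) = iter h (?s - 1)"
    using h(2) by (simp add: regular_at_def)
  show h': "h' \<in> set_pmf (run (Suc s))"
    using h(1) B unfolding h'_def by (auto simp: algorithm_step_p1 wpt intro!: bexI[of _ h])
  then obtain h'' where h'': "h'' \<in> set_pmf (run S)" "\<forall>k \<le> int (Suc s). iter h'' k = iter h' k"
    "\<forall>k < int (Suc s). dlt h'' k = dlt h' k"
    using algorithm_run_extends[OF Suc_leI[OF s] h'] by blast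
  have agree: "iter h'' (?s + 1) = X" "iter h'' ?s = iter h ?s" "iter h'' (?s - 1) = iter h (?s - 1)"
    "dlt h'' ?s = \<Delta>"
    using h''(2,3) by (auto simp: h'_eq)
  have avg: "mirror_avg f \<gamma> h'' ?s = mirror_avg f \<gamma> h ?s" "mirror_pt f \<gamma> h'' ?s = mirror_pt f \<gamma> h ?s"
    using agree by (simp_all add: mirror_avg_def mirror_pt_def)
  have "\<forall>k \<in> {0..int S}. iter h'' k \<in> dom_subdiff f"
    and step_ok: "\<forall>k \<in> {0..<int S}. mirror_avg f \<gamma> h'' k \<in> grad f ` dom_subdiff f \<and>
      (\<exists>z. is_arg_min (prox_objective f g \<alpha> (dlt h'' k) (mirror_pt f \<gamma> h'' k)) (\<lambda>x. x \<in> K) z)"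
    and x0: "x0 \<in> edom g"
    using well_defined h''(1) unfolding iterates_well_defined_def by blast+
  then have X: "X \<in> dom_subdiff f" using agree(1) s by force
  have ok: "mirror_avg f \<gamma> h ?s \<in> grad f ` dom_subdiff f"
    "\<exists>z. is_arg_min (prox_objective f g \<alpha> \<Delta> (mirror_pt f \<gamma> h ?s)) (\<lambda>x. x \<in> K) z"
    using bspec[OF step_ok, of ?s] s agree avg by auto
  have pt: "mirror_pt f \<gamma> h ?s \<in> dom_subdiff f" "grad f (mirror_pt f \<gamma> h ?s) = mirror_avg f \<gamma> h ?s"
    using the_inv_into_into[OF grad_inj_on ok(1) order.refl] f_the_inv_into_f[OF grad_inj_on ok(1)]
    by (auto simp: mirror_pt_def)
  have min: "is_arg_min (prox_objective f g \<alpha> \<Delta> (mirror_pt f \<gamma> h ?s)) (\<lambda>x. x \<in> K) X"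
    unfolding X_def arg_min_on_def arg_min_def using ok(2) by (rule someI_ex)
  note prox = prox_minimiser_subgradient[OF g \<alpha> x0 pt(1) min X]
  have res: "residual f F \<gamma> \<alpha> h' ?s = F X + (- \<Delta> - (1 / \<alpha>) *\<^sub>R (grad f X - grad f (mirror_pt f \<gamma> h ?s)))"
    by (simp add: residual_def h'_eq mirror_avg_def pt(2))
  show "regular_at (Suc s) h'"
    using h(2) X prox(1) unfolding regular_at_def h'_eq by auto
  show "- \<rho> * (dual_norm N (residual f F \<gamma> \<alpha> h' ?s))\<^sup>2
      \<le> residual f F \<gamma> \<alpha> h' ?s \<bullet> (iter h' (?s + 1) - xstar)"
    using weak_minty[OF _ prox(2)] prox(1) pcl_on_edom_subset[OF g] unfolding res by (auto simp: h'_eq)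
qed

lemma lyapunov_step:
  assumes s: "s < S" and h: "h \<in> set_pmf (run s)" "regular_at s h"
  shows "measure_pmf.expectation (replicate_pmf b (Q (iter h (int s)) (iter h (int s - 1))))
      (\<lambda>B. lyapunov (Suc s) (advance K f g F F\<xi> \<gamma> \<alpha> b (int s) h B)) \<le> lyapunov s h"
proof -
  define x x' where "x = iter h (int s)" and "x' = iter h (int s - 1)"
  define adv where "adv = advance K f g F F\<xi> \<gamma> \<alpha> b (int s) h"
  define z where "z B = iter (adv B) (int s + 1)" for B
  define u where "u B = residual f F \<gamma> \<alpha> (adv B) (int s)" for B
  define Y where "Y \<xi> = F\<xi> \<xi> x - F\<xi> \<xi> x'" for \<xi>
  define past where "past = \<omega> * (\<Sum>k<s. (dual_norm N (residual f F \<gamma> \<alpha> h (int k)))\<^sup>2)"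
  let ?R = "replicate_pmf b (Q x x')"
  have mem: "x \<in> edom g" "x' \<in> edom g" "x \<in> dom_subdiff f" "x' \<in> dom_subdiff f"
    and wpt: "wpt h (int s) = x" "wpt h (int s - 1) = x'"
    using h(2) by (auto simp: regular_at_def x_def x'_def)
  have "set_pmf (Q x x') \<subseteq> {1..M}"
    using variable_lip mem unfolding variable_lipschitz_oracle_def by blast
  then have fin: "finite (set_pmf (Q x x'))" by (rule finite_subset) simp
  have finR: "finite (set_pmf ?R)" by (rule finite_set_replicate_pmf[OF fin])
  have int: "integrable ?R k" for k :: "nat list \<Rightarrow> real"
    by (intro integrable_measure_pmf_finite finR)
  have mean: "measure_pmf.expectation (Q x x') Y = F x - F x'"
  proof -
    have "F y = measure_pmf.expectation (Q x x') (\<lambda>\<xi>. F\<xi> \<xi> y)" if "y \<in> edom g" for y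
      using variable_lip mem that unfolding variable_lipschitz_oracle_def by blast
    then show ?thesis
      using mem by (simp add: Y_def[abs_def] integrable_measure_pmf_finite[OF fin])
  qed
  have var: "measure_pmf.expectation (Q x x') (\<lambda>\<xi>. (dual_norm N (Y \<xi>))\<^sup>2) \<le> Lbar\<^sup>2 * (N (x - x'))\<^sup>2"
    using variable_lip mem unfolding variable_lipschitz_oracle_def Y_def by blast
  have adv_old: "iter (adv B) k = iter h k" if "k \<le> int s" for B k
    using that by (simp add: adv_def advance_def Let_def)
  have lyap_eq: "lyapunov (Suc s) (adv B) = (energy (z B) x + \<omega> * (dual_norm N (u B))\<^sup>2) + past" for B
  proof -
    have "residual f F \<gamma> \<alpha> (adv B) (int k) = residual f F \<gamma> \<alpha> h (int k)" if "k < s" for k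
      using that by (simp add: residual_def mirror_avg_def adv_def advance_def Let_def)
    then show ?thesis
      by (simp add: lyapunov_def past_def z_def u_def x_def adv_old algebra_simps)
  qed
  have "measure_pmf.expectation ?R (\<lambda>B. energy (z B) x + \<omega> * (dual_norm N (u B))\<^sup>2) \<le> energy x x'"
  proof (rule expected_energy_step[OF fin mem mean var])
    fix B assume B: "B \<in> set_pmf ?R"
    note reg = advance_regular[OF s h B[unfolded x_def x'_def], folded adv_def]
    show "z B \<in> edom g \<and> z B \<in> dom_subdiff f"
      using reg(2) by (simp add: regular_at_def z_def add.commute)
    show "- \<rho> * (dual_norm N (u B))\<^sup>2 \<le> u B \<bullet> (z B - xstar)"
      using reg(3) by (simp add: u_def z_def)
    have len: "length B = b" using B by (simp add: set_replicate_pmf)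
    have "(\<Sum>\<xi>\<leftarrow>B. F x + F\<xi> \<xi> x - F\<xi> \<xi> x') = real (length B) *\<^sub>R F x + (\<Sum>\<xi>\<leftarrow>B. Y \<xi>)"
      by (induction B) (auto simp: Y_def algebra_simps)
    then have "batch_estimate F F\<xi> b h (int s) B = F x + (1 / real b) *\<^sub>R (\<Sum>\<xi>\<leftarrow>B. Y \<xi>)"
      using len b unfolding batch_estimate_def wpt x_def[symmetric] by (simp add: scaleR_add_right)
    then have "dlt (adv B) (int s) = F x + (1 / real b) *\<^sub>R (\<Sum>\<xi>\<leftarrow>B. Y \<xi>)"
      by (simp add: adv_def advance_def Let_def)
    then show "u B = F (z B) - (F x + (1 / real b) *\<^sub>R (\<Sum>\<xi>\<leftarrow>B. Y \<xi>))
        - (1 / \<alpha>) *\<^sub>R (grad f (z B) - (\<gamma> *\<^sub>R grad f x + (1 - \<gamma>) *\<^sub>R grad f x'))"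
      by (simp add: u_def residual_def mirror_avg_def z_def adv_old x_def x'_def)
  qed
  then have "measure_pmf.expectation ?R (\<lambda>B. lyapunov (Suc s) (adv B)) \<le> energy x x' + past"
    by (simp add: lyap_eq int)
  then show ?thesis
    by (simp add: lyapunov_def past_def x_def x'_def adv_def)
qed

text \<open>Finite support and regularity are carried along in the induction because the oracle distributions
  are known to be finitely supported only at points of \<open>edom g\<close>. At the start both iterates are
  \<open>x0\<close>, which gives the factor \<open>2 - \<gamma>\<close>.\<close>
lemma expected_lyapunov_le:
  assumes "s \<le> S"
  shows "finite (set_pmf (run s)) \<and> (\<forall>h \<in> set_pmf (run s). regular_at s h) \<and>
    measure_pmf.expectation (run s) (lyapunov s) \<le> (2 - \<gamma>) * breg xstar x0"
  using assms
proof (induction s)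
  case 0
  obtain h' where "h' \<in> set_pmf (run S)" "iter h' 0 = x0"
    using algorithm_run_extends[of 0 S "Trajectory (\<lambda>_. x0) (\<lambda>_. x0) (\<lambda>_. 0)" K f g F F\<xi> Q \<gamma> \<alpha> b x0]
    by auto
  then have "x0 \<in> dom_subdiff f" "x0 \<in> edom g"
    using well_defined unfolding iterates_well_defined_def by (metis atLeastAtMost_iff of_nat_0_le_iff order.refl)+
  then show ?case by (simp add: regular_at_def lyapunov_def)
next
  case (Suc s)
  then have s: "s < S" and fin: "finite (set_pmf (run s))"
    and reg: "\<And>h. h \<in> set_pmf (run s) \<Longrightarrow> regular_at s h"
    and IH: "measure_pmf.expectation (run s) (lyapunov s) \<le> (2 - \<gamma>) * breg xstar x0"
    by auto
  define R where "R h = replicate_pmf b (Q (iter h (int s)) (iter h (int s - 1)))" for h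
  define adv where "adv = advance K f g F F\<xi> \<gamma> \<alpha> b (int s)"
  have step: "algorithm_step K f g F F\<xi> Q \<gamma> 1 \<alpha> b (int s) h = map_pmf (adv h) (R h)"
    if "h \<in> set_pmf (run s)" for h
    using reg[OF that] by (simp add: algorithm_step_p1 regular_at_def adv_def R_def)
  have finR: "finite (set_pmf (R h))" if "h \<in> set_pmf (run s)" for h
  proof -
    have "set_pmf (Q (iter h (int s)) (iter h (int s - 1))) \<subseteq> {1..M}"
      using reg[OF that] variable_lip unfolding variable_lipschitz_oracle_def regular_at_def by blast
    then show ?thesis unfolding R_def by (intro finite_set_replicate_pmf) (rule finite_subset, auto)
  qed
  have run_Suc: "run (Suc s) = bind_pmf (run s) (\<lambda>h. map_pmf (adv h) (R h))"
    using step by (simp cong: bind_pmf_cong_simp)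
  have "measure_pmf.expectation (run (Suc s)) (lyapunov (Suc s))
      = measure_pmf.expectation (run s) (\<lambda>h. measure_pmf.expectation (map_pmf (adv h) (R h)) (lyapunov (Suc s)))"
    unfolding run_Suc using fin finR by (intro expectation_bind_pmf) auto
  also have "\<dots> \<le> measure_pmf.expectation (run s) (lyapunov s)"
  proof (intro expectation_mono_pmf fin)
    fix h assume h: "h \<in> set_pmf (run s)"
    show "measure_pmf.expectation (map_pmf (adv h) (R h)) (lyapunov (Suc s)) \<le> lyapunov s h"
      using lyapunov_step[OF s h reg[OF h]] by (simp add: adv_def R_def)
  qed
  also note IH
  finally have "measure_pmf.expectation (run (Suc s)) (lyapunov (Suc s)) \<le> (2 - \<gamma>) * breg xstar x0" .
  moreover have "finite (set_pmf (run (Suc s)))"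
    unfolding run_Suc using fin finR by simp
  moreover have "regular_at (Suc s) h'" if "h' \<in> set_pmf (run (Suc s))" for h'
    using that advance_regular(2)[OF s _ reg] unfolding run_Suc by (auto simp: adv_def R_def)
  ultimately show ?case by blast
qed

lemma expected_residual_sum_le:
  "\<omega> * measure_pmf.expectation (run S) (\<lambda>h. \<Sum>s<S. (dual_norm N (residual f F \<gamma> \<alpha> h (int s)))\<^sup>2)
    \<le> (2 - \<gamma>) * breg xstar x0"
proof -
  have fin: "finite (set_pmf (run S))" and reg: "\<And>h. h \<in> set_pmf (run S) \<Longrightarrow> regular_at S h"
    and le: "measure_pmf.expectation (run S) (lyapunov S) \<le> (2 - \<gamma>) * breg xstar x0"
    using expected_lyapunov_le[of S] by auto
  have "\<omega> * measure_pmf.expectation (run S) (\<lambda>h. \<Sum>s<S. (dual_norm N (residual f F \<gamma> \<alpha> h (int s)))\<^sup>2)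
      = measure_pmf.expectation (run S) (\<lambda>h. \<omega> * (\<Sum>s<S. (dual_norm N (residual f F \<gamma> \<alpha> h (int s)))\<^sup>2))"
    by simp
  also have "\<dots> \<le> measure_pmf.expectation (run S) (lyapunov S)"
  proof (intro expectation_mono_pmf fin)
    fix h assume "h \<in> set_pmf (run S)"
    from reg[OF this] show "\<omega> * (\<Sum>s<S. (dual_norm N (residual f F \<gamma> \<alpha> h (int s)))\<^sup>2) \<le> lyapunov S h"
      by (simp add: lyapunov_def regular_at_def energy_nonneg)
  qed
  finally show ?thesis using le by simp
qed

end

section \<open>Step-size conditions and the convergence bound\<close>

text \<open>Here \<open>q\<close> stands for \<open>Lf\<^sup>2 / \<alpha>\<^sup>2\<close> and \<open>l\<close> for \<open>Lbar\<^sup>2 / b\<close>. With \<open>\<omega> = \<sigma>1 / \<sigma>2\<close> the definition of \<open>\<sigma>1\<close>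
  becomes the balance \<open>\<kappa> * \<sigma>2 = (\<gamma> - 1/2) - 2 * \<alpha>\<^sup>2 * m\<close>. As the left side is positive, \<open>\<gamma> > 1/2\<close> and
  \<open>\<alpha>\<^sup>2 * m\<close> is small; as \<open>\<sigma>2\<close> contains \<open>8 * \<gamma> * q\<close>, the product \<open>\<kappa> * q\<close> is at most 1/4.\<close>
lemma stepsize_budget:
  fixes \<gamma> \<alpha> \<rho> L l q \<sigma>1 \<sigma>2 :: real
  assumes pos: "0 < \<gamma>" "\<gamma> \<le> 1" "0 < \<alpha>" "0 < \<rho>" "0 < q" "0 \<le> l"
    and \<sigma>1: "\<sigma>1 = (\<gamma> - 1/2) - (4 * \<alpha>\<^sup>2 * L\<^sup>2 + 5 * \<alpha>\<^sup>2 * l) - \<alpha> * \<rho> * \<sigma>2"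
    and \<sigma>2: "\<sigma>2 = 16 * L\<^sup>2 + 8 * \<gamma> * q + 8 * l"
    and \<sigma>1_pos: "0 < \<sigma>1"
  defines "\<kappa> \<equiv> \<sigma>1 / \<sigma>2 + \<alpha> * \<rho>" and "m \<equiv> 2 * L\<^sup>2 + 5/2 * l"
  shows "0 < \<sigma>2" "1/2 < \<gamma>"
    and "(\<alpha>\<^sup>2 + 4 * \<kappa> * (\<alpha>\<^sup>2 * q)) * m + \<kappa> * (2 * \<gamma> * q + 4 * L\<^sup>2) \<le> (\<gamma> - 1/2) / 2"
    and "2 * \<kappa> * q \<le> 1/2"
proof -
  show \<sigma>2_pos: "0 < \<sigma>2"
    unfolding \<sigma>2 using pos by (intro add_pos_nonneg add_nonneg_pos) auto
  have \<kappa>: "0 < \<kappa>" unfolding \<kappa>_def using \<sigma>1_pos \<sigma>2_pos pos by (intro add_pos_pos) auto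
  have bal: "\<kappa> * \<sigma>2 = (\<gamma> - 1/2) - 2 * (\<alpha>\<^sup>2 * m)"
  proof -
    have "\<kappa> * \<sigma>2 = \<sigma>1 + \<alpha> * \<rho> * \<sigma>2" using \<sigma>2_pos by (simp add: \<kappa>_def distrib_right)
    then show ?thesis unfolding \<sigma>1 by (simp add: m_def algebra_simps)
  qed
  have m: "0 \<le> \<alpha>\<^sup>2 * m" unfolding m_def using pos by simp
  have "0 < \<kappa> * \<sigma>2" using \<kappa> \<sigma>2_pos by simp
  then show "1/2 < \<gamma>" using bal m by linarith
  have "\<kappa> * (8 * \<gamma> * q) \<le> \<kappa> * \<sigma>2" unfolding \<sigma>2 using \<kappa> pos by (intro mult_left_mono) auto
  also have "\<dots> \<le> 2 * \<gamma>" using bal m pos by linarith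
  finally have "\<gamma> * (4 * \<kappa> * q) \<le> \<gamma> * 1" by (simp add: algebra_simps)
  then have "4 * \<kappa> * q \<le> 1" using pos(1) by (simp only: mult_le_cancel_left_pos)
  then show "2 * \<kappa> * q \<le> 1/2" by simp
  have "\<alpha>\<^sup>2 * m \<le> \<gamma> / 2" using bal \<open>0 < \<kappa> * \<sigma>2\<close> by linarith
  then have "4 * (\<kappa> * q) * (\<alpha>\<^sup>2 * m) \<le> 4 * (\<kappa> * q) * (\<gamma> / 2)"
    using \<kappa> pos by (intro mult_left_mono) auto
  moreover have "\<kappa> * \<sigma>2 = 16 * (\<kappa> * L\<^sup>2) + 8 * (\<kappa> * \<gamma> * q) + 8 * (\<kappa> * l)"
    by (simp add: \<sigma>2 algebra_simps)
  moreover have "0 \<le> \<kappa> * l" "0 \<le> \<kappa> * L\<^sup>2" using \<kappa> pos by auto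
  ultimately have "4 * (\<kappa> * q) * (\<alpha>\<^sup>2 * m) + (2 * (\<kappa> * \<gamma> * q) + 4 * (\<kappa> * L\<^sup>2)) \<le> (\<gamma> - 1/2) / 2 - \<alpha>\<^sup>2 * m"
    using bal by (simp add: algebra_simps)
  then show "(\<alpha>\<^sup>2 + 4 * \<kappa> * (\<alpha>\<^sup>2 * q)) * m + \<kappa> * (2 * \<gamma> * q + 4 * L\<^sup>2) \<le> (\<gamma> - 1/2) / 2"
    by (simp add: algebra_simps)
qed

theorem theorem3p5:
  fixes N :: "'a::euclidean_space \<Rightarrow> real"
    and K :: "'a set"
    and f g :: "'a \<Rightarrow> ereal"
    and F :: "'a \<Rightarrow> 'a"
    and Fi F\<xi> :: "nat \<Rightarrow> 'a \<Rightarrow> 'a"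
    and Q :: "'a \<Rightarrow> 'a \<Rightarrow> nat pmf"
    and M b S :: nat
    and \<gamma> \<alpha> \<rho> L Lbar Lf \<sigma>1 \<sigma>2 :: real
    and x0 xstar :: 'a
  defines "R \<equiv> algorithm_run K f g F F\<xi> Q \<gamma> 1 \<alpha> b x0 S"
  assumes norm: "is_norm N"
    and K: "K \<noteq> {}" "closed K" "convex K"
    and g: "pcl_on K g"
    and F: "\<forall>x \<in> edom g. F x = (1 / real M) *\<^sub>R (\<Sum>i = 1..M. Fi i x)"
    and f: "bregman_generator N K g f"
    and params: "0 < \<gamma>" "\<gamma> \<le> 1" "0 < \<alpha>" "b \<in> {1..M}"
    and start: "x0 \<in> K"
    and well_defined: "iterates_well_defined K f g \<gamma> \<alpha> x0 S R"
    and A1: "vi_solutions K g F \<noteq> {}"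
    and A3: "variable_lipschitz_oracle N g F M F\<xi> Q Lbar"
    and A4: "\<forall>x \<in> K \<inter> edom g. \<forall>y \<in> K \<inter> edom g. dual_norm N (F x - F y) \<le> L * N (x - y)"
    and A5: "xstar \<in> K" "0 < \<rho>"
      "\<forall>x \<in> K. \<forall>w \<in> (\<lambda>v. F x + v) ` subdifferential (\<lambda>z. g z + convex_indicator K z) x.
         - \<rho> * (dual_norm N w)\<^sup>2 \<le> w \<bullet> (x - xstar)"
    and A6: "0 < Lf"
      "\<forall>x \<in> K \<inter> dom_subdiff f. \<forall>y \<in> K \<inter> dom_subdiff f.
         dual_norm N (grad f x - grad f y) \<le> Lf * N (x - y)"
    and \<sigma>1: "\<sigma>1 = (\<gamma> - 1/2) -
      (4 * \<alpha>\<^sup>2 * L\<^sup>2 + 16 * \<alpha> * \<rho> * L\<^sup>2 + 8 * \<alpha> * \<rho> * Lbar\<^sup>2 / real b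
        + 5 * \<alpha>\<^sup>2 * Lbar\<^sup>2 / real b + 8 * \<gamma> * \<rho> * Lf\<^sup>2 / \<alpha>)"
    and \<sigma>2: "\<sigma>2 = 16 * L\<^sup>2 + 8 * \<gamma> * Lf\<^sup>2 / \<alpha>\<^sup>2 + 8 * Lbar\<^sup>2 / real b"
    and \<sigma>1_pos: "0 < \<sigma>1"
    and cond: "(1 - \<gamma>) * (\<sigma>1 / \<sigma>2 * (8 * \<rho> * Lf\<^sup>2 / \<alpha> - 1) + 8 * Lf\<^sup>2 / \<alpha>\<^sup>2) \<le> 0"
  shows "ereal (measure_pmf.expectation R (\<lambda>h. \<Sum>s<S. (dual_norm N (residual f F \<gamma> \<alpha> h (int s)))\<^sup>2))
      \<le> ereal ((3 - \<gamma>) * \<sigma>2 / \<sigma>1) * bregman f xstar x0"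
proof -
  define q where "q = Lf\<^sup>2 / \<alpha>\<^sup>2"
  define l where "l = Lbar\<^sup>2 / real b"
  define \<kappa> where "\<kappa> = \<sigma>1 / \<sigma>2 + \<alpha> * \<rho>"
  define m where "m = 2 * L\<^sup>2 + 5/2 * l"
  have Lf_eq: "Lf\<^sup>2 = \<alpha>\<^sup>2 * q" using params(3) by (simp add: q_def)
  have q: "0 < q" and l: "0 \<le> l" using A6(1) params(3) by (simp_all add: q_def l_def)
  have \<sigma>2': "\<sigma>2 = 16 * L\<^sup>2 + 8 * \<gamma> * q + 8 * l"
    by (simp add: \<sigma>2 q_def l_def)
  have \<sigma>1': "\<sigma>1 = (\<gamma> - 1/2) - (4 * \<alpha>\<^sup>2 * L\<^sup>2 + 5 * \<alpha>\<^sup>2 * l) - \<alpha> * \<rho> * \<sigma>2"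
    unfolding \<sigma>1 \<sigma>2' using params(3) Lf_eq by (simp add: l_def power2_eq_square field_simps)
  note budget = stepsize_budget[OF params(1-3) A5(2) q l \<sigma>1' \<sigma>2' \<sigma>1_pos, folded \<kappa>_def m_def]
  \<comment> \<open>every trajectory starts at \<open>x0\<close>; one of positive probability exists\<close>
  have x0_sub: "x0 \<in> dom_subdiff f"
  proof -
    obtain h' where "h' \<in> set_pmf R" "iter h' 0 = x0"
      using algorithm_run_extends[of 0 S "Trajectory (\<lambda>_. x0) (\<lambda>_. x0) (\<lambda>_. 0)" K f g F F\<xi> Q \<gamma> \<alpha> b x0]
      by (auto simp: R_def)
    then show ?thesis using well_defined unfolding iterates_well_defined_def by force
  qed
  interpret bregman_kernel N K f g
    using norm f x0_sub by unfold_locales auto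
  show ?thesis
  proof (cases "xstar \<in> edom f")
    case False
    \<comment> \<open>the right-hand side of the claim is infinite\<close>
    then have "f xstar = \<infinity>" by (simp add: edom_def)
    moreover obtain r where "f x0 = ereal r" using f_eq_fr x0_sub dom_subdiff_subset by blast
    ultimately have "bregman f xstar x0 = \<infinity>"
      by (simp add: bregman_def)
    then show ?thesis using params(2) budget(1) \<sigma>1_pos by auto
  next
    case True
    interpret reflected_run N K f g F xstar b \<alpha> \<gamma> \<rho> L Lbar Lf "\<sigma>1 / \<sigma>2" \<kappa> m
      "(\<alpha>\<^sup>2 + 4 * \<kappa> * Lf\<^sup>2) * m" M S F\<xi> Q x0
    proof unfold_locales
      show "0 \<le> \<sigma>1 / \<sigma>2" using budget(1) \<sigma>1_pos by simp
      show "(\<alpha>\<^sup>2 + 4 * \<kappa> * Lf\<^sup>2) * m + \<kappa> * (2 * \<gamma> * (Lf\<^sup>2 / \<alpha>\<^sup>2) + 4 * L\<^sup>2) \<le> (\<gamma> - 1/2) / 2"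
        using budget(3) by (simp add: Lf_eq[symmetric] q_def[symmetric])
      show "2 * \<kappa> * (Lf\<^sup>2 / \<alpha>\<^sup>2) \<le> 1/2" using budget(4) by (simp add: q_def)
      show "dual_norm N (F x - F y) \<le> L * N (x - y)" if "x \<in> edom g" "y \<in> edom g" for x y
        using A4 that pcl_on_edom_subset[OF g] by blast
      show "dual_norm N (grad f x - grad f y) \<le> Lf * N (x - y)"
        if "x \<in> dom_subdiff f" "y \<in> dom_subdiff f" for x y
        using A6(2) that edom_subset dom_subdiff_subset by blast
      show "- \<rho> * (dual_norm N (F x + v))\<^sup>2 \<le> (F x + v) \<bullet> (x - xstar)"
        if "x \<in> K" "v \<in> subdifferential (\<lambda>z. g z + convex_indicator K z) x" for x v
        using A5(3) that by blast
    qed (use True params A5(2) budget(2) g A3 well_defined in \<open>auto simp: \<kappa>_def m_def l_def R_def\<close>)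
    let ?E = "measure_pmf.expectation R (\<lambda>h. \<Sum>s<S. (dual_norm N (residual f F \<gamma> \<alpha> h (int s)))\<^sup>2)"
    have V: "0 \<le> breg xstar x0"
      using breg_ge[OF True x0_sub] zero_le_power2[of "N (xstar - x0)"] by linarith
    have "\<sigma>1 / \<sigma>2 * ?E \<le> (2 - \<gamma>) * breg xstar x0"
      using expected_residual_sum_le unfolding R_def .
    also have "\<dots> \<le> (3 - \<gamma>) * breg xstar x0"
      using V by (intro mult_right_mono) auto
    finally have "?E \<le> (3 - \<gamma>) * \<sigma>2 / \<sigma>1 * breg xstar x0"
      using budget(1) \<sigma>1_pos by (simp add: field_simps)
    then show ?thesis
      by (simp add: bregman_eq_breg[OF True x0_sub])
  qed
qed

end
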